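(* Let $F \colon \mathbf{Cstar} \to \mathbf{AWstar}$ be a functor equipped with natural unital $*$-homomorphisms $\eta_A \colon A \to F(A)$, one for each unital C*-algebra $A$ (naturality meaning $F(f) \circ \eta_A = \eta_B \circ f$ for every unital $*$-homomorphism $f \colon A \to B$). Suppose that for each compact Hausdorff space $X$ there is an isomorphism $F(C(X)) \cong \ell^\infty(X)$ that turns $\eta_{C(X)}$ into the natural inclusion $C(X) \to \ell^\infty(X)$ (that is, the composite of $\eta_{C(X)}$ with this isomorphism is the inclusion). If a unital C*-algebra $A$ admits a unital $*$-homomorphism $\alpha \colon B(K) \to A$ for some infinite-dimensional Hilbert space $K$, then $F(A) = 0$.
   Context: All algebras are over $\mathbb{C}$; the zero algebra is allowed as a unital C*-algebra and as an AW*-algebra. $\mathbf{Cstar}$ denotes the category of unital C*-algebras with unital $*$-homomorphisms. An AW*-algebra is a (unital) C*-algebra in which the right annihilator of every subset is of the form $pM$ for a projection $p$ (i.e. a C*-algebra that is a Baer $*$-ring); its projections form a complete lattice. $\mathbf{AWstar}$ denotes the category whose objects are AW*-algebras and whose morphisms are unital $*$-homomorphisms whose restriction to the projection lattices preserves arbitrary least upper bounds. For a compact Hausdorff space $X$, $C(X)$ is the C*-algebra of continuous complex functions on $X$, and $\ell^\infty(X)$ is the algebra of all bounded complex functions on the set $X$. $B(K)$ is the C*-algebra of bounded operators on $K$. *)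

theory Defs
  imports "HOL-Analysis.Analysis" "HOL-Algebra.Module" "HOL-Algebra.Order"
begin

section \<open>Unital C*-algebras\<close>

definition complex_ring :: "complex ring" where
  "complex_ring = \<lparr>carrier = UNIV, mult = (*), one = 1, zero = 0, add = (+)\<rparr>"

record 'a star_algebra = "(complex, 'a) module" +
  star :: "'a \<Rightarrow> 'a"
  nrm :: "'a \<Rightarrow> real"

text \<open>The ring axioms do not exclude that one equals zero, so the zero algebra is included.\<close>

locale cstar_algebra = ring A + module complex_ring A for A :: "'a star_algebra" (structure) +
  assumes smult_mult_left:
      "\<lbrakk>x \<in> carrier A; y \<in> carrier A\<rbrakk> \<Longrightarrow> (c \<odot> x) \<otimes> y = c \<odot> (x \<otimes> y)"
    and smult_mult_right:
      "\<lbrakk>x \<in> carrier A; y \<in> carrier A\<rbrakk> \<Longrightarrow> x \<otimes> (c \<odot> y) = c \<odot> (x \<otimes> y)"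
    and star_closed: "x \<in> carrier A \<Longrightarrow> star A x \<in> carrier A"
    and star_star: "x \<in> carrier A \<Longrightarrow> star A (star A x) = x"
    and star_add:
      "\<lbrakk>x \<in> carrier A; y \<in> carrier A\<rbrakk> \<Longrightarrow> star A (x \<oplus> y) = star A x \<oplus> star A y"
    and star_smult: "x \<in> carrier A \<Longrightarrow> star A (c \<odot> x) = cnj c \<odot> star A x"
    and star_mult:
      "\<lbrakk>x \<in> carrier A; y \<in> carrier A\<rbrakk> \<Longrightarrow> star A (x \<otimes> y) = star A y \<otimes> star A x"
    and nrm_nonneg: "x \<in> carrier A \<Longrightarrow> 0 \<le> nrm A x"
    and nrm_eq_0: "x \<in> carrier A \<Longrightarrow> nrm A x = 0 \<longleftrightarrow> x = \<zero>"
    and nrm_smult: "x \<in> carrier A \<Longrightarrow> nrm A (c \<odot> x) = cmod c * nrm A x"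
    and nrm_triangle:
      "\<lbrakk>x \<in> carrier A; y \<in> carrier A\<rbrakk> \<Longrightarrow> nrm A (x \<oplus> y) \<le> nrm A x + nrm A y"
    and nrm_mult:
      "\<lbrakk>x \<in> carrier A; y \<in> carrier A\<rbrakk> \<Longrightarrow> nrm A (x \<otimes> y) \<le> nrm A x * nrm A y"
    and cstar_identity: "x \<in> carrier A \<Longrightarrow> nrm A (star A x \<otimes> x) = (nrm A x)\<^sup>2"
    and complete:
      "\<lbrakk>range s \<subseteq> carrier A;
        \<And>e. e > 0 \<Longrightarrow> \<exists>N::nat. \<forall>m\<ge>N. \<forall>n\<ge>N. nrm A (s m \<ominus> s n) < e\<rbrakk>
       \<Longrightarrow> \<exists>l\<in>carrier A. (\<lambda>n. nrm A (s n \<ominus> l)) \<longlonglongrightarrow> 0"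

text \<open>Morphisms are extensional, so that two of them are equal as soon as they agree on
  the carrier.\<close>

definition star_hom :: "'a star_algebra \<Rightarrow> 'b star_algebra \<Rightarrow> ('a \<Rightarrow> 'b) set" where
  "star_hom A B = {f \<in> ring_hom A B \<inter> extensional (carrier A).
     (\<forall>c. \<forall>x\<in>carrier A. f (c \<odot>\<^bsub>A\<^esub> x) = c \<odot>\<^bsub>B\<^esub> f x) \<and>
     (\<forall>x\<in>carrier A. f (star A x) = star B (f x))}"

definition star_iso :: "'a star_algebra \<Rightarrow> 'b star_algebra \<Rightarrow> ('a \<Rightarrow> 'b) set" where
  "star_iso A B = {f \<in> star_hom A B. bij_betw f (carrier A) (carrier B)}"

section \<open>AW*-algebras\<close>

definition projections :: "'a star_algebra \<Rightarrow> 'a set" where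
  "projections A = {p \<in> carrier A. p \<otimes>\<^bsub>A\<^esub> p = p \<and> star A p = p}"

definition right_annihilator :: "'a star_algebra \<Rightarrow> 'a set \<Rightarrow> 'a set" where
  "right_annihilator A S = {x \<in> carrier A. \<forall>s\<in>S. s \<otimes>\<^bsub>A\<^esub> x = \<zero>\<^bsub>A\<^esub>}"

locale awstar_algebra = cstar_algebra +
  assumes baer: "S \<subseteq> carrier A \<Longrightarrow>
    \<exists>p\<in>projections A. right_annihilator A S = {p \<otimes> x |x. x \<in> carrier A}"

definition projection_order :: "'a star_algebra \<Rightarrow> 'a gorder" where
  "projection_order A =
     \<lparr>carrier = projections A, eq = (=), le = (\<lambda>p q. p \<otimes>\<^bsub>A\<^esub> q = p)\<rparr>"

definition is_projection_sup :: "'a star_algebra \<Rightarrow> 'a set \<Rightarrow> 'a \<Rightarrow> bool" where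
  "is_projection_sup A P p \<longleftrightarrow> least (projection_order A) p (Upper (projection_order A) P)"

definition aw_hom :: "'a star_algebra \<Rightarrow> 'b star_algebra \<Rightarrow> ('a \<Rightarrow> 'b) set" where
  "aw_hom M N = {f \<in> star_hom M N. \<forall>P p. P \<subseteq> projections M \<longrightarrow>
     is_projection_sup M P p \<longrightarrow> is_projection_sup N (f ` P) (f p)}"

section \<open>Function algebras\<close>

text \<open>The \<open>insert 0\<close> makes the supremum norm zero when \<open>S\<close> is empty.\<close>

definition function_algebra ::
    "'x set \<Rightarrow> ('x \<Rightarrow> complex) set \<Rightarrow> ('x \<Rightarrow> complex) star_algebra" where
  "function_algebra S K =
     \<lparr>carrier = K,
      mult = (\<lambda>f g. \<lambda>x\<in>S. f x * g x),
      one = (\<lambda>x\<in>S. 1),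
      zero = (\<lambda>x\<in>S. 0),
      add = (\<lambda>f g. \<lambda>x\<in>S. f x + g x),
      smult = (\<lambda>c f. \<lambda>x\<in>S. c * f x),
      star = (\<lambda>f. \<lambda>x\<in>S. cnj (f x)),
      nrm = (\<lambda>f. Sup (insert 0 ((\<lambda>x. cmod (f x)) ` S)))\<rparr>"

definition continuous_functions :: "'x topology \<Rightarrow> ('x \<Rightarrow> complex) star_algebra" where
  "continuous_functions X = function_algebra (topspace X)
     {f \<in> extensional (topspace X). continuous_map X euclidean f}"

definition bounded_functions :: "'x set \<Rightarrow> ('x \<Rightarrow> complex) star_algebra" where
  "bounded_functions S = function_algebra S {f \<in> extensional S. bounded (f ` S)}"

section \<open>Hilbert spaces and their algebras of bounded operators\<close>

class chilbert_space = banach +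
  fixes scaleC :: "complex \<Rightarrow> 'a \<Rightarrow> 'a"
    and cinner :: "'a \<Rightarrow> 'a \<Rightarrow> complex"
  assumes scaleC_add_right: "scaleC c (x + y) = scaleC c x + scaleC c y"
    and scaleC_add_left: "scaleC (c + d) x = scaleC c x + scaleC d x"
    and scaleC_scaleC: "scaleC c (scaleC d x) = scaleC (c * d) x"
    and scaleC_of_real: "scaleC (complex_of_real r) x = r *\<^sub>R x"
    and cinner_commute: "cinner x y = cnj (cinner y x)"
    and cinner_add_right: "cinner x (y + z) = cinner x y + cinner x z"
    and cinner_scaleC_right: "cinner x (scaleC c y) = c * cinner x y"
    and cinner_self: "cinner x x = complex_of_real ((norm x)\<^sup>2)"

definition infinite_dimensional :: "'k::chilbert_space itself \<Rightarrow> bool" where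
  "infinite_dimensional TYPE('k) \<longleftrightarrow>
     \<not> (\<exists>B. finite B \<and> module.span scaleC B = (UNIV :: 'k set))"

definition bounded_operators :: "('k::chilbert_space \<Rightarrow>\<^sub>L 'k) star_algebra" where
  "bounded_operators =
     \<lparr>carrier = {T. \<forall>c x. blinfun_apply T (scaleC c x) = scaleC c (blinfun_apply T x)},
      mult = blinfun_compose,
      one = id_blinfun,
      zero = 0,
      add = (+),
      smult = (\<lambda>c T. Blinfun (\<lambda>x. scaleC c (blinfun_apply T x))),
      star = (\<lambda>T. THE S. \<forall>x y. cinner (blinfun_apply T x) y = cinner x (blinfun_apply S y)),
      nrm = norm\<rparr>"

section \<open>Functors and natural transformations\<close>

text \<open>There is no type of all C*-algebras, so \<open>Cstar\<close> and \<open>AWstar\<close> are rendered as the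
  categories of all such algebras carried by subsets of arbitrary types \<open>'u\<close> and \<open>'v\<close>.
  The objects of \<open>Cstar\<close> then include an isomorphic copy of every C*-algebra whose cardinality
  does not exceed that of \<open>'u\<close>.\<close>

locale cstar_awstar_functor =
  fixes Fobj :: "'u star_algebra \<Rightarrow> 'v star_algebra"
    and Fmap :: "'u star_algebra \<Rightarrow> 'u star_algebra \<Rightarrow> ('u \<Rightarrow> 'u) \<Rightarrow> ('v \<Rightarrow> 'v)"
  assumes obj: "cstar_algebra A \<Longrightarrow> awstar_algebra (Fobj A)"
    and map: "\<lbrakk>cstar_algebra A; cstar_algebra B; f \<in> star_hom A B\<rbrakk>
      \<Longrightarrow> Fmap A B f \<in> aw_hom (Fobj A) (Fobj B)"
    and map_id: "cstar_algebra A
      \<Longrightarrow> Fmap A A (\<lambda>x\<in>carrier A. x) = (\<lambda>x\<in>carrier (Fobj A). x)"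
    and map_comp: "\<lbrakk>cstar_algebra A; cstar_algebra B; cstar_algebra C;
        f \<in> star_hom A B; g \<in> star_hom B C\<rbrakk>
      \<Longrightarrow> Fmap A C (compose (carrier A) g f)
          = compose (carrier (Fobj A)) (Fmap B C g) (Fmap A B f)"

locale natural_star_homs = cstar_awstar_functor Fobj Fmap
  for Fobj :: "'u star_algebra \<Rightarrow> 'v star_algebra" and Fmap +
  fixes \<eta> :: "'u star_algebra \<Rightarrow> 'u \<Rightarrow> 'v"
  assumes component: "cstar_algebra A \<Longrightarrow> \<eta> A \<in> star_hom A (Fobj A)"
    and natural: "\<lbrakk>cstar_algebra A; cstar_algebra B; f \<in> star_hom A B\<rbrakk>
      \<Longrightarrow> compose (carrier A) (Fmap A B f) (\<eta> A) = compose (carrier A) (\<eta> B) f"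

text \<open>In the next definition \<open>C\<close> is an object of \<open>Cstar\<close> and \<open>\<phi>\<close> identifies it with \<open>C(X)\<close>.
  Letting \<open>X\<close> range over topologies on subsets of \<open>'u \<Rightarrow> complex\<close> loses no space: by the lemma
  below, every compact Hausdorff space for which \<open>C(X)\<close> is isomorphic to an object of \<open>Cstar\<close>
  is homeomorphic to one of these.\<close>

definition discretizes_continuous_functions ::
    "('u star_algebra \<Rightarrow> 'v star_algebra) \<Rightarrow> ('u star_algebra \<Rightarrow> 'u \<Rightarrow> 'v) \<Rightarrow> bool" where
  "discretizes_continuous_functions Fobj \<eta> \<longleftrightarrow>
     (\<forall>(X :: ('u \<Rightarrow> complex) topology) C \<phi>.
        compact_space X \<longrightarrow> Hausdorff_space X \<longrightarrow>
        cstar_algebra C \<longrightarrow> \<phi> \<in> star_iso (continuous_functions X) C \<longrightarrow>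
        (\<exists>\<psi> \<in> star_iso (Fobj C) (bounded_functions (topspace X)).
           \<forall>f \<in> carrier (continuous_functions X). \<psi> (\<eta> C (\<phi> f)) = f))"

lemma compact_Hausdorff_representable:
  fixes X :: "'x topology" and C :: "'u star_algebra"
  assumes X: "compact_space X" "Hausdorff_space X"
    and \<phi>: "\<phi> \<in> star_iso (continuous_functions X) C"
  shows "\<exists>Y :: ('u \<Rightarrow> complex) topology. X homeomorphic_space Y"
proof -
  let ?K = "carrier (continuous_functions X)"
  have inj\<phi>: "inj_on \<phi> ?K"
    using \<phi> by (auto simp: star_iso_def bij_betw_def)
  define h where "h = (\<lambda>x u. if u \<in> \<phi> ` ?K then inv_into ?K \<phi> u x else 0)"
  have h: "h x (\<phi> f) = f x" if "f \<in> ?K" for x f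
    using that inj\<phi> by (simp add: h_def)
  have inj: "inj_on h (topspace X)"
  proof (rule inj_onI, rule ccontr)
    fix x y assume xy: "x \<in> topspace X" "y \<in> topspace X" "h x = h y" "x \<noteq> y"
    have "completely_regular_space X"
      using X by (simp add: normal_imp_completely_regular_space
          compact_Hausdorff_or_regular_imp_normal_space)
    moreover have "closedin X {y}"
      using X xy by (simp add: Hausdorff_imp_t1_space closedin_t1_singleton)
    ultimately obtain g :: "'x \<Rightarrow> real" where g: "continuous_map X euclideanreal g"
        "g x = 0" "g y = 1"
      using xy unfolding completely_regular_space_alt by force
    define f where "f = (\<lambda>z\<in>topspace X. complex_of_real (g z))"
    have "continuous_map X euclidean (\<lambda>z. complex_of_real (g z))"
      using continuous_map_compose[OF g(1), of euclidean complex_of_real]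
      by (simp add: o_def)
    then have "continuous_map X euclidean f"
      unfolding f_def by (rule continuous_map_eq) auto
    then have "f \<in> ?K"
      by (simp add: continuous_functions_def function_algebra_def f_def)
    then have "f x = f y"
      using h xy(3) by metis
    then show False
      using xy g by (simp add: f_def)
  qed
  define k where "k = inv_into (topspace X) h"
  define Y where "Y = pullback_topology (h ` topspace X) k X"
  have kh: "k (h x) = x" if "x \<in> topspace X" for x
    using that inj by (simp add: k_def)
  have tY: "topspace Y = h ` topspace X"
    using kh by (auto simp: Y_def topspace_pullback_topology)
  have "continuous_map Y X k"
    unfolding Y_def using continuous_map_pullback[OF continuous_map_id] by (simp add: o_def)
  moreover have "continuous_map X Y h"
    unfolding Y_def
  proof (rule continuous_map_pullback')
    show "continuous_map X X (k \<circ> h)"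
      using continuous_map_id by (rule continuous_map_eq) (simp add: kh)
  qed auto
  ultimately have "homeomorphic_maps X Y h k"
    using kh tY by (auto simp: homeomorphic_maps_def)
  then show ?thesis
    by (auto simp: homeomorphic_space_def)
qed

end

theory Submission
  imports Defs "HOL-Algebra.Subrings"
begin

text \<open>An infinite-dimensional \<open>K\<close> is isomorphic to \<open>K \<oplus> K\<close>, so \<open>A\<close> contains isometries \<open>s\<^sub>0\<close>, \<open>s\<^sub>1\<close>
  with orthogonal ranges and \<open>s\<^sub>0 s\<^sub>0\<^sup>* + s\<^sub>1 s\<^sub>1\<^sup>* = 1\<close>. Write \<open>s\<^sub>x\<close> for the product of the \<open>s\<^sub>i\<close> along a
  finite binary word \<open>x\<close>. The range projections \<open>s\<^sub>x s\<^sub>x\<^sup>*\<close> span a copy of the locally constant functions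
  on the Cantor space \<open>X\<close>, whose closure is \<open>C(X)\<close>. Since \<open>F(C(X)) = \<ell>\<^sup>\<infinity>(X)\<close>, the atoms of \<open>\<ell>\<^sup>\<infinity>(X)\<close> give
  projections \<open>p\<close> in \<open>F(A)\<close> with supremum 1, each of them below \<open>\<eta>(s\<^sub>x s\<^sub>x\<^sup>*)\<close> for all initial segments \<open>x\<close>
  of some point of \<open>X\<close>. The pair \<open>t\<^sub>\<plusminus> = (s\<^sub>0 \<plusminus> s\<^sub>1) / \<surd>2\<close> satisfies the same relations and gives projections
  \<open>q\<close> with supremum 1. For words of length \<open>n\<close> the element \<open>t\<^sub>y\<^sup>* s\<^sub>x\<close> is a scalar of modulus
  \<open>2\<^sup>-\<^sup>n\<^sup>/\<^sup>2\<close>, hence \<open>q p = 0\<close> for all \<open>p\<close> and \<open>q\<close>. As the \<open>q\<close> have supremum 1, every \<open>p\<close> is zero, and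
  then their supremum 1 is zero.\<close>

lemma carrier_complex_ring [simp]: "carrier complex_ring = UNIV"
  and mult_complex_ring [simp]: "mult complex_ring = (*)"
  and add_complex_ring [simp]: "add complex_ring = (+)"
  and one_complex_ring [simp]: "one complex_ring = 1"
  and zero_complex_ring [simp]: "zero complex_ring = 0"
  by (auto simp: complex_ring_def)

subsection \<open>C*-algebras\<close>

context cstar_algebra
begin

lemma ring_A: "ring A" and abelian_group_A: "abelian_group A" and abelian_monoid_A: "abelian_monoid A"
  using cstar_algebra_axioms
  by (auto simp: cstar_algebra_def ring_def abelian_group_def)

text \<open>Inside the locale the unqualified names refer to the scalar ring.\<close>

lemmas minus_equality' = abelian_group.minus_equality[OF abelian_group_A]
  and minus_simps = a_minus_def abelian_group.minus_add[OF abelian_group_A]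
    abelian_group.r_neg[OF abelian_group_A] abelian_group.l_neg[OF abelian_group_A]
    abelian_group.r_neg1[OF abelian_group_A] abelian_group.r_neg2[OF abelian_group_A]
    abelian_group.minus_minus[OF abelian_group_A]
  and add_ac = abelian_monoid.a_assoc[OF abelian_monoid_A] abelian_monoid.a_comm[OF abelian_monoid_A]
    abelian_monoid.a_lcomm[OF abelian_monoid_A]
  and mult_assoc = ring.ring_simprules(11)[OF ring_A]
  and distrib = ring.ring_simprules(13,23)[OF ring_A] ring.l_minus[OF ring_A] ring.r_minus[OF ring_A]


lemma smult_in_carrier [simp]: "x \<in> carrier A \<Longrightarrow> c \<odot> x \<in> carrier A"
  using smult_closed[of c x] by simp

lemma smult_add_left: "x \<in> carrier A \<Longrightarrow> (c + d) \<odot> x = c \<odot> x \<oplus> d \<odot> x"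
  using smult_l_distr[of c d x] by simp

lemma smult_add_right:
  "\<lbrakk>x \<in> carrier A; y \<in> carrier A\<rbrakk> \<Longrightarrow> c \<odot> (x \<oplus> y) = c \<odot> x \<oplus> c \<odot> y"
  using smult_r_distr[of c x y] by simp

lemma smult_smult: "x \<in> carrier A \<Longrightarrow> c \<odot> (d \<odot> x) = (c * d) \<odot> x"
  using smult_assoc1[of c d x] by simp

lemma smult_1 [simp]: "x \<in> carrier A \<Longrightarrow> 1 \<odot> x = x"
  using smult_one[of x] by simp

lemma smult_0 [simp]: "x \<in> carrier A \<Longrightarrow> 0 \<odot> x = \<zero>"
  using smult_l_null[of x] by simp

lemma smult_0_right [simp]: "c \<odot> \<zero> = \<zero>"
  using smult_r_null[of c] by simp

lemma uminus_eq_smult: "x \<in> carrier A \<Longrightarrow> \<ominus> x = (- 1) \<odot> x"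
  by (rule minus_equality')
    (use smult_add_left[of x "- 1" 1] in auto)

declare star_closed [simp] star_star [simp]

lemma star_zero [simp]: "star A \<zero> = \<zero>"
  using star_smult[of \<zero> 0] by simp

lemma star_one [simp]: "star A \<one> = \<one>"
proof -
  have "star A \<one> = star A (star A (star A \<one>) \<otimes> star A \<one>)"
    using star_mult[of "star A (star A \<one>)" "star A \<one>"] by simp
  then show ?thesis by simp
qed

lemma star_uminus: "x \<in> carrier A \<Longrightarrow> star A (\<ominus> x) = \<ominus> star A x"
  by (simp add: uminus_eq_smult star_smult)

lemma star_minus:
  "\<lbrakk>x \<in> carrier A; y \<in> carrier A\<rbrakk> \<Longrightarrow> star A (x \<ominus> y) = star A x \<ominus> star A y"
  by (simp add: a_minus_def star_add star_uminus)

lemma smult_minus_right: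
  "\<lbrakk>x \<in> carrier A; y \<in> carrier A\<rbrakk> \<Longrightarrow> c \<odot> (x \<ominus> y) = c \<odot> x \<ominus> c \<odot> y"
  by (simp add: a_minus_def smult_add_right uminus_eq_smult smult_smult mult.commute)

lemma nrm_zero [simp]: "nrm A \<zero> = 0"
  by (simp add: nrm_eq_0)

lemma nrm_uminus [simp]: "x \<in> carrier A \<Longrightarrow> nrm A (\<ominus> x) = nrm A x"
  by (simp add: uminus_eq_smult nrm_smult)

lemma minus_add_minus:
  assumes "x \<in> carrier A" "y \<in> carrier A" "z \<in> carrier A"
  shows "(x \<ominus> y) \<oplus> (y \<ominus> z) = x \<ominus> z"
  using assms by (simp add: minus_simps add_ac)

lemma minus_minus_swap:
  assumes "x \<in> carrier A" "y \<in> carrier A"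
  shows "\<ominus> (x \<ominus> y) = y \<ominus> x"
  using assms by (simp add: minus_simps add_ac)

lemma nrm_minus_commute:
  assumes "x \<in> carrier A" "y \<in> carrier A"
  shows "nrm A (x \<ominus> y) = nrm A (y \<ominus> x)"
  using assms nrm_uminus[of "x \<ominus> y"] by (simp add: minus_minus_swap)

lemma nrm_minus_triangle:
  assumes "x \<in> carrier A" "y \<in> carrier A" "z \<in> carrier A"
  shows "nrm A (x \<ominus> z) \<le> nrm A (x \<ominus> y) + nrm A (y \<ominus> z)"
  using nrm_triangle[of "x \<ominus> y" "y \<ominus> z"] assms by (simp add: minus_add_minus)

lemma nrm_le_minus:
  assumes "x \<in> carrier A" "y \<in> carrier A"
  shows "nrm A x \<le> nrm A (x \<ominus> y) + nrm A y"
  using nrm_minus_triangle[of x y \<zero>] assms by (simp add: a_minus_def)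

lemma minus_eq_zero_iff:
  "\<lbrakk>x \<in> carrier A; y \<in> carrier A\<rbrakk> \<Longrightarrow> x \<ominus> y = \<zero> \<longleftrightarrow> x = y"
  by simp

text \<open>By the C*-identity the square of the norm of \<open>x\<close> is at most
  \<open>nrm A (star A x) * nrm A x\<close>; one factor cancels. Used for \<open>x\<close> and for
  \<open>star A x\<close>, this makes the involution isometric.\<close>

lemma nrm_le_star: "x \<in> carrier A \<Longrightarrow> nrm A x \<le> nrm A (star A x)"
proof -
  assume x: "x \<in> carrier A"
  have "nrm A x * nrm A x \<le> nrm A (star A x) * nrm A x"
    using cstar_identity[OF x] nrm_mult[of "star A x" x] x by (simp add: power2_eq_square)
  then show ?thesis
    using nrm_nonneg[OF x] nrm_nonneg[of "star A x"] x
    by (cases "nrm A x = 0") (auto simp: mult_le_cancel_right)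
qed

lemma nrm_star [simp]: "x \<in> carrier A \<Longrightarrow> nrm A (star A x) = nrm A x"
  using nrm_le_star[of x] nrm_le_star[of "star A x"] by simp

text \<open>The C*-identity makes \<open>nrm A \<one>\<close> a root of t^2 = t. Only an inequality
  can be stated, since the zero algebra gives the root 0.\<close>

lemma nrm_one_le: "nrm A \<one> \<le> 1"
proof -
  have "(nrm A \<one>)\<^sup>2 = nrm A \<one>"
    using cstar_identity[of \<one>] by simp
  then have "nrm A \<one> * (nrm A \<one> - 1) = 0"
    by (simp add: power2_eq_square algebra_simps)
  then show ?thesis by auto
qed

lemma nrm_isometry_le:
  assumes "s \<in> carrier A" "star A s \<otimes> s = \<one>"
  shows "nrm A s \<le> 1"
proof -
  have "(nrm A s)\<^sup>2 \<le> 1"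
    using cstar_identity[OF assms(1)] assms(2) nrm_one_le by simp
  then show ?thesis
    using abs_square_le_1[of "nrm A s"] by simp
qed

lemma nrm_projection_le:
  assumes "p \<in> projections A"
  shows "nrm A p \<le> 1"
proof -
  have p: "p \<in> carrier A" "star A p \<otimes> p = p"
    using assms by (auto simp: projections_def)
  then have "nrm A p * (nrm A p - 1) = 0"
    using cstar_identity[of p] by (simp add: power2_eq_square algebra_simps)
  then show ?thesis by auto
qed

section \<open>Limits in norm\<close>

text \<open>The type \<open>'a\<close> carries no topology, so convergence is expressed through
  \<open>nrm A\<close>. Membership in the carrier is built in because the algebraic laws hold only
  there.\<close>

definition lim :: "(nat \<Rightarrow> 'a) \<Rightarrow> 'a \<Rightarrow> bool" where
  "lim s l \<longleftrightarrow> range s \<subseteq> carrier A \<and> l \<in> carrier A \<and> (\<lambda>n. nrm A (s n \<ominus> l)) \<longlonglongrightarrow> 0"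

lemma limD [simp]: "lim s l \<Longrightarrow> s n \<in> carrier A" "lim s l \<Longrightarrow> l \<in> carrier A"
  by (auto simp: lim_def)

lemma limI_bound:
  assumes "\<And>n. s n \<in> carrier A" "l \<in> carrier A" "r \<longlonglongrightarrow> 0"
    and "\<And>n. nrm A (s n \<ominus> l) \<le> r n"
  shows "lim s l"
  unfolding lim_def
proof (intro conjI)
  show "(\<lambda>n. nrm A (s n \<ominus> l)) \<longlonglongrightarrow> 0"
    by (rule tendsto_sandwich[OF _ _ tendsto_const assms(3)])
      (use assms nrm_nonneg in \<open>auto intro!: always_eventually\<close>)
qed (use assms in auto)

lemma lim_tendsto_nrm: "lim s l \<Longrightarrow> (\<lambda>n. nrm A (s n \<ominus> l)) \<longlonglongrightarrow> 0"
  by (simp add: lim_def)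

lemma lim_const: "a \<in> carrier A \<Longrightarrow> lim (\<lambda>n. a) a"
  by (rule limI_bound[where r = "\<lambda>_. 0"]) (auto simp: minus_simps)

lemma lim_unique:
  assumes "lim s a" "lim s b"
  shows "a = b"
proof -
  have "(\<lambda>n. nrm A (s n \<ominus> a) + nrm A (s n \<ominus> b)) \<longlonglongrightarrow> 0"
    using tendsto_add[OF lim_tendsto_nrm[OF assms(1)] lim_tendsto_nrm[OF assms(2)]] by simp
  moreover have "nrm A (a \<ominus> b) \<le> nrm A (s n \<ominus> a) + nrm A (s n \<ominus> b)" for n
    using nrm_minus_triangle[of a "s n" b] assms by (simp add: nrm_minus_commute)
  ultimately have "nrm A (a \<ominus> b) \<le> 0"
    by (intro LIMSEQ_le_const) auto
  then show ?thesis
    using assms nrm_nonneg[of "a \<ominus> b"] nrm_eq_0[of "a \<ominus> b"] by (simp add: minus_eq_zero_iff)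
qed

lemma lim_nrm:
  assumes "lim s l"
  shows "(\<lambda>n. nrm A (s n)) \<longlonglongrightarrow> nrm A l"
proof (rule LIMSEQ_I)
  fix r :: real assume "r > 0"
  then obtain N where N: "\<And>n. n \<ge> N \<Longrightarrow> norm (nrm A (s n \<ominus> l)) < r"
    using LIMSEQ_D[OF lim_tendsto_nrm[OF assms], of r] by auto
  have "norm (nrm A (s n) - nrm A l) < r" if "n \<ge> N" for n
    using N[OF that] nrm_le_minus[of "s n" l] nrm_le_minus[of l "s n"] assms
      nrm_minus_commute[of l "s n"] by (auto simp: abs_if)
  then show "\<exists>N. \<forall>n\<ge>N. norm (nrm A (s n) - nrm A l) < r" by blast
qed

lemma lim_add:
  assumes "lim s a" "lim t b"
  shows "lim (\<lambda>n. s n \<oplus> t n) (a \<oplus> b)"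
proof (rule limI_bound)
  show "(\<lambda>n. nrm A (s n \<ominus> a) + nrm A (t n \<ominus> b)) \<longlonglongrightarrow> 0"
    using tendsto_add[OF lim_tendsto_nrm[OF assms(1)] lim_tendsto_nrm[OF assms(2)]] by simp
  fix n
  have "(s n \<oplus> t n) \<ominus> (a \<oplus> b) = (s n \<ominus> a) \<oplus> (t n \<ominus> b)"
    using assms by (simp add: minus_simps add_ac)
  then show "nrm A ((s n \<oplus> t n) \<ominus> (a \<oplus> b)) \<le> nrm A (s n \<ominus> a) + nrm A (t n \<ominus> b)"
    using nrm_triangle assms by simp
qed (use assms in auto)

lemma lim_smult:
  assumes "lim s a"
  shows "lim (\<lambda>n. c \<odot> s n) (c \<odot> a)"
proof (rule limI_bound)
  show "(\<lambda>n. cmod c * nrm A (s n \<ominus> a)) \<longlonglongrightarrow> 0"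
    using tendsto_mult_left[OF lim_tendsto_nrm[OF assms], of "cmod c"] by simp
qed (use assms in \<open>auto simp: smult_minus_right[symmetric] nrm_smult\<close>)

lemma lim_star:
  assumes "lim s a"
  shows "lim (\<lambda>n. star A (s n)) (star A a)"
  by (rule limI_bound[OF _ _ lim_tendsto_nrm[OF assms]])
    (use assms in \<open>auto simp: star_minus[symmetric]\<close>)

text \<open>The difference of the products splits as \<open>s n \<otimes> (t n \<ominus> b) \<oplus>
  (s n \<ominus> a) \<otimes> b\<close>, and the norms of the \<open>s n\<close> converge, so they
  stay bounded.\<close>

lemma lim_mult:
  assumes "lim s a" "lim t b"
  shows "lim (\<lambda>n. s n \<otimes> t n) (a \<otimes> b)"
proof (rule limI_bound)
  have "(\<lambda>n. nrm A (s n) * nrm A (t n \<ominus> b) + nrm A (s n \<ominus> a) * nrm A b)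
      \<longlonglongrightarrow> nrm A a * 0 + 0 * nrm A b"
    by (intro tendsto_intros lim_tendsto_nrm lim_nrm assms)
  then show "(\<lambda>n. nrm A (s n) * nrm A (t n \<ominus> b) + nrm A (s n \<ominus> a) * nrm A b) \<longlonglongrightarrow> 0"
    by simp
  fix n
  have c: "s n \<in> carrier A" "t n \<in> carrier A" "a \<in> carrier A" "b \<in> carrier A"
    using assms by auto
  have "(s n \<otimes> t n) \<ominus> (a \<otimes> b) = s n \<otimes> (t n \<ominus> b) \<oplus> (s n \<ominus> a) \<otimes> b"
    using c minus_add_minus[of "s n \<otimes> t n" "s n \<otimes> b" "a \<otimes> b"]
    by (simp add: a_minus_def distrib)
  then show "nrm A ((s n \<otimes> t n) \<ominus> (a \<otimes> b))
      \<le> nrm A (s n) * nrm A (t n \<ominus> b) + nrm A (s n \<ominus> a) * nrm A b"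
    using nrm_triangle[of "s n \<otimes> (t n \<ominus> b)" "(s n \<ominus> a) \<otimes> b"]
      nrm_mult[of "s n" "t n \<ominus> b"] nrm_mult[of "s n \<ominus> a" b] c by simp
qed (use assms in auto)

end

text \<open>The algebraic and norm axioms are inherited directly; closedness under limits turns
  completeness of \<open>A\<close> into completeness of \<open>H\<close>.\<close>

lemma cstar_subalgebra:
  assumes "cstar_algebra A" and H: "H \<subseteq> carrier A" "\<one>\<^bsub>A\<^esub> \<in> H"
    and add: "\<And>x y. x \<in> H \<Longrightarrow> y \<in> H \<Longrightarrow> x \<oplus>\<^bsub>A\<^esub> y \<in> H"
    and mult: "\<And>x y. x \<in> H \<Longrightarrow> y \<in> H \<Longrightarrow> x \<otimes>\<^bsub>A\<^esub> y \<in> H"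
    and smult: "\<And>c x. x \<in> H \<Longrightarrow> c \<odot>\<^bsub>A\<^esub> x \<in> H"
    and star: "\<And>x. x \<in> H \<Longrightarrow> star A x \<in> H"
    and closed: "\<And>s l. range s \<subseteq> H \<Longrightarrow> cstar_algebra.lim A s l \<Longrightarrow> l \<in> H"
  shows "cstar_algebra (A\<lparr>carrier := H\<rparr>)"
proof -
  interpret cstar_algebra A by fact
  let ?C = "A\<lparr>carrier := H\<rparr>"
  have H': "x \<in> carrier A" if "x \<in> H" for x using that H by auto
  have neg: "\<ominus>\<^bsub>A\<^esub> x \<in> H" if "x \<in> H" for x
    using smult[OF that, of "- 1"] H'[OF that] by (simp add: uminus_eq_smult)
  have zero: "\<zero>\<^bsub>A\<^esub> \<in> H"
    using smult[OF H(2), of 0] by simp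
  have rC: "ring ?C"
    by (rule ring.subring_is_ring[OF ring_A], rule ring.subringI[OF ring_A]) (use H neg mult add in auto)
  interpret C: ring ?C by fact
  have "submodule H complex_ring A"
    by (rule submoduleI) (use H zero neg add smult in auto)
  then have mC: "module complex_ring ?C"
    by (rule submodule.submodule_is_module) unfold_locales
  \<comment> \<open>An additive inverse is defined by a description over the carrier, so the
    inverses in \<open>?C\<close> and in \<open>A\<close> have to be compared explicitly.\<close>
  have neg_eq: "\<ominus>\<^bsub>?C\<^esub> x = \<ominus>\<^bsub>A\<^esub> x" if "x \<in> H" for x
    by (rule C.minus_equality) (use that neg H' minus_simps in auto)
  have minus_eq: "x \<ominus>\<^bsub>?C\<^esub> y = x \<ominus>\<^bsub>A\<^esub> y" if "x \<in> H" "y \<in> H" for x y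
    using that neg_eq by (simp add: a_minus_def)
  show ?thesis
  proof (intro cstar_algebra.intro rC mC, unfold_locales, goal_cases)
    \<comment> \<open>This case is completeness: the limit exists in \<open>A\<close>, and
      \<open>closed\<close> places it in \<open>H\<close>.\<close>
    case (14 s)
    have s: "range s \<subseteq> H" using 14(1) by simp
    then have sn: "s n \<in> H" for n by auto
    have "range s \<subseteq> carrier A" using s H by auto
    moreover have "\<exists>N. \<forall>m\<ge>N. \<forall>n\<ge>N. nrm A (s m \<ominus>\<^bsub>A\<^esub> s n) < e" if "e > 0" for e
      using 14(2)[OF that] minus_eq[OF sn sn] by simp
    ultimately obtain l where l: "l \<in> carrier A" "(\<lambda>n. nrm A (s n \<ominus>\<^bsub>A\<^esub> l)) \<longlonglongrightarrow> 0"
      using complete[of s] by auto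
    then have "lim s l"
      using \<open>range s \<subseteq> carrier A\<close> by (simp add: lim_def)
    then have "l \<in> H" using closed s by blast
    then show ?case using l minus_eq[OF sn] by (intro bexI[of _ l]) auto
  qed (auto simp: H' smult_mult_left smult_mult_right star_add star_smult star_mult star
      nrm_nonneg nrm_eq_0 nrm_smult nrm_triangle nrm_mult cstar_identity)
qed

subsection \<open>The Cantor space inside a Cuntz algebra\<close>

text \<open>If \<open>x > M > 0\<close>, the powers of \<open>x / M\<close> are unbounded, and
  \<open>n \<le> 2 ^ n\<close> carries this over to the exponents \<open>2 ^ n\<close>, so the
  factor 2 is eventually exceeded.\<close>

lemma le_of_power_le:
  fixes x M :: real
  assumes M: "0 \<le> M" and le: "\<And>k. x ^ (2 ^ k) \<le> 2 * M ^ (2 ^ k)"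
  shows "x \<le> M"
proof (rule ccontr)
  assume "\<not> x \<le> M"
  then have x: "M < x" by simp
  show False
  proof (cases "M = 0")
    case True
    then show ?thesis using le[of 0] x by simp
  next
    case False
    then have M: "M > 0" using M by simp
    obtain n where n: "2 < (x / M) ^ n"
      using real_arch_pow[of "x / M" 2] x M by auto
    also have "(x / M) ^ n \<le> (x / M) ^ (2 ^ n)"
      using x M by (intro power_increasing) auto
    also have "\<dots> \<le> 2"
      using le[of n] M by (simp add: power_divide divide_simps)
    finally show False by simp
  qed
qed

definition cylinder_function :: "nat \<Rightarrow> (nat \<Rightarrow> bool) \<Rightarrow> (nat \<Rightarrow> bool) \<Rightarrow> complex" where
  "cylinder_function n x y = (if \<forall>i<n. y i = x i then 1 else 0)"

text \<open>\<open>case_nat b y\<close> puts the bit \<open>b\<close> in front of \<open>y\<close>.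
  Splitting off the first bit matches the recursion of \<open>step\<close> and \<open>word\<close>
  below.\<close>

lemma cylinder_function_Suc:
  "cylinder_function (Suc n) x (case_nat b y) =
    (if b = x 0 then cylinder_function n (\<lambda>i. x (Suc i)) y else 0)"
  by (auto simp: cylinder_function_def All_less_Suc2)

text \<open>Uniform continuity for the uniformity given by cylinders. This form feeds the norm
  estimates directly; compactness later derives it from continuity.\<close>

definition cantor_ucont :: "((nat \<Rightarrow> bool) \<Rightarrow> complex) \<Rightarrow> bool" where
  "cantor_ucont f \<longleftrightarrow>
     (\<forall>e>0. \<exists>n. \<forall>x y. (\<forall>i<n. x i = y i) \<longrightarrow> cmod (f x - f y) \<le> e)"

section \<open>Cuntz pairs and diagonal matrices\<close>

text \<open>These are the relations of the Cuntz algebra O_2. The zero algebra satisfies them too,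
  so \<open>\<one> \<noteq> \<zero>\<close> is assumed separately where lower norm bounds are
  needed.\<close>

locale cuntz_pair = cstar_algebra A for A :: "'a star_algebra" (structure) +
  fixes s :: "bool \<Rightarrow> 'a"
  assumes s_closed [simp]: "s b \<in> carrier A"
    and star_s_s: "star A (s b) \<otimes> s c = (if b = c then \<one> else \<zero>)"
    and s_complete: "s False \<otimes> star A (s False) \<oplus> s True \<otimes> star A (s True) = \<one>"
begin

lemma star_s_s_mult: "x \<in> carrier A \<Longrightarrow> star A (s b) \<otimes> (s c \<otimes> x) = (if b = c then x else \<zero>)"
  using mult_assoc[of "star A (s b)" "s c" x, symmetric] by (cases "b = c") (simp_all add: star_s_s)

lemma nrm_s_le: "nrm A (s b) \<le> 1"
  by (rule nrm_isometry_le) (auto simp: star_s_s)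

text \<open>The block diagonal matrix diag(a, b), under the identification of 2 by 2 matrices over
  \<open>A\<close> with \<open>A\<close> that the pair provides.\<close>

definition theta :: "'a \<Rightarrow> 'a \<Rightarrow> 'a" where
  "theta a b = s False \<otimes> a \<otimes> star A (s False) \<oplus> s True \<otimes> b \<otimes> star A (s True)"

lemma theta_closed [simp]: "\<lbrakk>a \<in> carrier A; b \<in> carrier A\<rbrakk> \<Longrightarrow> theta a b \<in> carrier A"
  by (simp add: theta_def)

lemma theta_mult:
  "\<lbrakk>a \<in> carrier A; b \<in> carrier A; c \<in> carrier A; d \<in> carrier A\<rbrakk>
    \<Longrightarrow> theta a b \<otimes> theta c d = theta (a \<otimes> c) (b \<otimes> d)"
  by (simp add: theta_def distrib mult_assoc star_s_s_mult)

lemma theta_add: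
  "\<lbrakk>a \<in> carrier A; b \<in> carrier A; c \<in> carrier A; d \<in> carrier A\<rbrakk>
    \<Longrightarrow> theta a b \<oplus> theta c d = theta (a \<oplus> c) (b \<oplus> d)"
  by (simp add: theta_def distrib add_ac)

lemma theta_smult:
  "\<lbrakk>a \<in> carrier A; b \<in> carrier A\<rbrakk> \<Longrightarrow> c \<odot> theta a b = theta (c \<odot> a) (c \<odot> b)"
  by (simp add: theta_def smult_add_right smult_mult_left smult_mult_right)

lemma theta_star:
  "\<lbrakk>a \<in> carrier A; b \<in> carrier A\<rbrakk> \<Longrightarrow> star A (theta a b) = theta (star A a) (star A b)"
  by (simp add: theta_def star_add star_mult mult_assoc)

lemma theta_minus:
  "\<lbrakk>a \<in> carrier A; b \<in> carrier A; c \<in> carrier A; d \<in> carrier A\<rbrakk>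
    \<Longrightarrow> theta a b \<ominus> theta c d = theta (a \<ominus> c) (b \<ominus> d)"
  by (simp add: a_minus_def uminus_eq_smult theta_smult theta_add)

lemma theta_one: "theta \<one> \<one> = \<one>"
  by (simp add: theta_def s_complete)

lemma nrm_conj_s_le:
  assumes "a \<in> carrier A"
  shows "nrm A (s b \<otimes> a \<otimes> star A (s b)) \<le> nrm A a"
    and "nrm A (star A (s b) \<otimes> a \<otimes> s b) \<le> nrm A a"
proof -
  have *: "nrm A (x \<otimes> a \<otimes> y) \<le> nrm A a"
    if "x \<in> carrier A" "y \<in> carrier A" "nrm A x \<le> 1" "nrm A y \<le> 1" for x y
  proof -
    have "nrm A (x \<otimes> a \<otimes> y) \<le> nrm A x * nrm A a * nrm A y"
      using nrm_mult[of "x \<otimes> a" y] mult_right_mono[OF nrm_mult[of x a] nrm_nonneg[of y]]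
        that assms by simp
    also have "\<dots> \<le> 1 * nrm A a * 1"
      using that assms nrm_nonneg by (intro mult_mono) auto
    finally show ?thesis by simp
  qed
  show "nrm A (s b \<otimes> a \<otimes> star A (s b)) \<le> nrm A a"
    and "nrm A (star A (s b) \<otimes> a \<otimes> s b) \<le> nrm A a"
    using nrm_s_le assms by (auto intro!: *)
qed

text \<open>The C*-identity turns the crude bound \<open>2 M\<close> for \<open>theta a b\<close> into the bound \<open>2 M\<^sup>2\<close> for
  its square, and so on; the factor 2 disappears in the limit.\<close>

lemma nrm_theta_le:
  assumes "a \<in> carrier A" "b \<in> carrier A" "nrm A a \<le> M" "nrm A b \<le> M"
  shows "nrm A (theta a b) \<le> M"
proof (rule le_of_power_le)
  show "0 \<le> M" using assms nrm_nonneg[of a] by simp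
  show "nrm A (theta a b) ^ (2 ^ k) \<le> 2 * M ^ (2 ^ k)" for k
    using assms
  proof (induction k arbitrary: a b M)
    case 0
    then show ?case
      using nrm_triangle[of "s False \<otimes> a \<otimes> star A (s False)" "s True \<otimes> b \<otimes> star A (s True)"]
        nrm_conj_s_le(1)[of a False] nrm_conj_s_le(1)[of b True] by (simp add: theta_def)
  next
    case (Suc k)
    have M: "nrm A (star A a \<otimes> a) \<le> M\<^sup>2" "nrm A (star A b \<otimes> b) \<le> M\<^sup>2"
      using Suc.prems nrm_nonneg by (auto simp: cstar_identity intro!: power_mono)
    have "nrm A (theta a b) ^ 2 ^ Suc k = ((nrm A (theta a b))\<^sup>2) ^ 2 ^ k"
      by (simp add: power_mult)
    also have "(nrm A (theta a b))\<^sup>2 = nrm A (theta (star A a \<otimes> a) (star A b \<otimes> b))"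
      using Suc.prems by (simp add: cstar_identity[symmetric] theta_star theta_mult)
    also have "\<dots> ^ 2 ^ k \<le> 2 * (M\<^sup>2) ^ 2 ^ k"
      using Suc.prems M by (intro Suc.IH) auto
    finally show ?case by (simp add: power_mult)
  qed
qed

text \<open>Compression by \<open>s False\<close> or \<open>s True\<close> recovers the two entries
  and does not increase the norm. With \<open>nrm_theta_le\<close>, the norm of
  \<open>theta a b\<close> is the maximum of the norms of its entries.\<close>

lemma nrm_le_theta:
  assumes "a \<in> carrier A" "b \<in> carrier A"
  shows "nrm A a \<le> nrm A (theta a b)" "nrm A b \<le> nrm A (theta a b)"
proof -
  have "star A (s False) \<otimes> theta a b \<otimes> s False = a" "star A (s True) \<otimes> theta a b \<otimes> s True = b"
    using assms by (simp_all add: theta_def distrib mult_assoc star_s_s_mult star_s_s)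
  then show "nrm A a \<le> nrm A (theta a b)" "nrm A b \<le> nrm A (theta a b)"
    using nrm_conj_s_le(2)[of "theta a b" False] nrm_conj_s_le(2)[of "theta a b" True] assms
    by simp_all
qed

text \<open>\<open>step n f\<close> is the diagonal matrix of size \<open>2 ^ n\<close> that samples \<open>f\<close> at one point of each
  cylinder of depth \<open>n\<close>.\<close>

primrec step :: "nat \<Rightarrow> ((nat \<Rightarrow> bool) \<Rightarrow> complex) \<Rightarrow> 'a" where
  "step 0 f = f (\<lambda>_. False) \<odot> \<one>"
| "step (Suc n) f = theta (step n (\<lambda>x. f (case_nat False x))) (step n (\<lambda>x. f (case_nat True x)))"

lemma step_closed [simp]: "step n f \<in> carrier A"
  by (induction n arbitrary: f) auto

lemma step_add: "step n (\<lambda>x. f x + g x) = step n f \<oplus> step n g"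
  by (induction n arbitrary: f g) (auto simp: theta_add smult_add_left)

lemma step_mult: "step n (\<lambda>x. f x * g x) = step n f \<otimes> step n g"
  by (induction n arbitrary: f g)
    (auto simp: theta_mult smult_mult_left smult_mult_right smult_smult mult.commute)

lemma step_smult: "step n (\<lambda>x. c * f x) = c \<odot> step n f"
  by (induction n arbitrary: f) (auto simp: theta_smult smult_smult)

lemma step_cnj: "step n (\<lambda>x. cnj (f x)) = star A (step n f)"
  by (induction n arbitrary: f) (auto simp: theta_star star_smult)

lemma step_const: "step n (\<lambda>x. c) = c \<odot> \<one>"
proof -
  have "step n (\<lambda>x. 1) = \<one>"
    by (induction n) (auto simp: theta_one)
  then show ?thesis
    using step_smult[of n c "\<lambda>_. 1"] by simp
qed

lemma step_minus: "step n (\<lambda>x. f x - g x) = step n f \<ominus> step n g"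
  using step_add[of n f "\<lambda>x. (- 1) * g x"] step_smult[of n "- 1" g]
  by (simp add: a_minus_def uminus_eq_smult)

lemma nrm_step_le:
  assumes "\<And>x. cmod (f x) \<le> M"
  shows "nrm A (step n f) \<le> M"
  using assms
proof (induction n arbitrary: f)
  case 0
  have "cmod (f (\<lambda>_. False)) * nrm A \<one> \<le> M * 1"
    using 0 nrm_one_le nrm_nonneg by (intro mult_mono) (auto intro: order_trans[OF norm_ge_zero])
  then show ?case by (simp add: nrm_smult)
next
  case (Suc n)
  then show ?case by (auto intro!: nrm_theta_le)
qed

text \<open>At depth 0 the coarse sample is a constant, which \<open>step m\<close> reproduces
  exactly, so \<open>nrm_step_le\<close> applies. Each further bit is split off by
  \<open>theta\<close>, whose norm is controlled by its two halves.\<close>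

lemma nrm_step_diff_le:
  assumes "\<And>x y. (\<forall>i<n. x i = y i) \<Longrightarrow> cmod (f x - f y) \<le> e" and "n \<le> m"
  shows "nrm A (step m f \<ominus> step n f) \<le> e"
  using assms
proof (induction n arbitrary: f m)
  case 0
  have "step m f \<ominus> step 0 f = step m (\<lambda>x. f x - f (\<lambda>_. False))"
    by (simp add: step_minus step_const)
  then show ?case
    using 0 by (simp add: nrm_step_le)
next
  case (Suc n)
  then obtain m' where m: "m = Suc m'" "n \<le> m'" by (cases m) auto
  have "nrm A (step m' (\<lambda>x. f (case_nat b x)) \<ominus> step n (\<lambda>x. f (case_nat b x))) \<le> e" for b
    by (rule Suc.IH) (use m in \<open>auto intro!: Suc.prems(1) split: nat.split\<close>)
  then show ?case
    unfolding m(1) by (auto simp: theta_minus intro!: nrm_theta_le)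
qed

text \<open>The sampled values are the diagonal entries of \<open>step n f\<close>: the sample point
  follows \<open>x\<close> for \<open>n\<close> bits and continues with \<open>False\<close>.
  Following the bits of \<open>x\<close> through \<open>nrm_le_theta\<close> isolates one
  entry.\<close>

lemma le_nrm_step:
  assumes "\<one> \<noteq> \<zero>"
  shows "cmod (f (\<lambda>i. if i < n then x i else False)) \<le> nrm A (step n f)"
proof (induction n arbitrary: f x)
  case 0
  have "nrm A \<one> = 1"
    using assms cstar_identity[of \<one>] nrm_eq_0[of \<one>] by (simp add: power2_eq_square)
  then show ?case by (simp add: nrm_smult)
next
  case (Suc n)
  have "(\<lambda>i. if i < Suc n then x i else False)
      = case_nat (x 0) (\<lambda>i. if i < n then x (Suc i) else False)"
    by (auto simp: fun_eq_iff split: nat.split)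
  then have "cmod (f (\<lambda>i. if i < Suc n then x i else False))
      \<le> nrm A (step n (\<lambda>y. f (case_nat (x 0) y)))"
    using Suc.IH[of "\<lambda>y. f (case_nat (x 0) y)" "\<lambda>i. x (Suc i)"] by simp
  also have "\<dots> \<le> nrm A (step (Suc n) f)"
    by (cases "x 0") (auto intro: nrm_le_theta)
  finally show ?case .
qed

primrec word :: "nat \<Rightarrow> (nat \<Rightarrow> bool) \<Rightarrow> 'a" where
  "word 0 x = \<one>"
| "word (Suc n) x = s (x 0) \<otimes> word n (\<lambda>i. x (Suc i))"

lemma word_closed [simp]: "word n x \<in> carrier A"
  by (induction n arbitrary: x) auto

lemma star_word_word: "star A (word n x) \<otimes> word n x = \<one>"
  by (induction n arbitrary: x) (auto simp: star_mult mult_assoc star_s_s_mult)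

text \<open>From depth \<open>n\<close> on, the sampling no longer loses information about the
  cylinder. At each bit one of the two blocks is zero and the other is conjugated by
  \<open>s (x 0)\<close>.\<close>

lemma step_cylinder:
  "n \<le> m \<Longrightarrow> step m (cylinder_function n x) = word n x \<otimes> star A (word n x)"
proof (induction n arbitrary: m x)
  case 0
  have "cylinder_function 0 x = (\<lambda>_. 1)" by (simp add: cylinder_function_def fun_eq_iff)
  then show ?case by (simp add: step_const)
next
  case (Suc n)
  then obtain m' where m: "m = Suc m'" "n \<le> m'" by (cases m) auto
  show ?case
    unfolding m(1) using Suc.IH[OF m(2)]
    by (cases "x 0") (simp_all add: cylinder_function_Suc step_const theta_def star_mult mult_assoc)
qed

section \<open>The representation of continuous functions on the Cantor space\<close>

text \<open>The description is meaningful for \<open>cantor_ucont\<close> functions, where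
  \<open>lim_Phi\<close> supplies the limit.\<close>

definition Phi :: "((nat \<Rightarrow> bool) \<Rightarrow> complex) \<Rightarrow> 'a" where
  "Phi f = (THE l. lim (\<lambda>n. step n f) l)"

lemma Phi_eqI: "lim (\<lambda>n. step n f) l \<Longrightarrow> Phi f = l"
  unfolding Phi_def by (rule the_equality) (auto intro: lim_unique)

lemma lim_Phi:
  assumes "cantor_ucont f"
  shows "lim (\<lambda>n. step n f) (Phi f)"
proof -
  have "\<exists>l\<in>carrier A. (\<lambda>n. nrm A (step n f \<ominus> l)) \<longlonglongrightarrow> 0"
  proof (rule complete)
    fix e :: real assume "e > 0"
    \<comment> \<open>Two errors of at most \<open>e / 3\<close> leave room for the strict bound
      required by \<open>complete\<close>.\<close>
    then have "e / 3 > 0" by simp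
    with assms obtain n where n: "\<forall>x y. (\<forall>i<n. x i = y i) \<longrightarrow> cmod (f x - f y) \<le> e / 3"
      unfolding cantor_ucont_def by blast
    have "nrm A (step k f \<ominus> step m f) < e" if "k \<ge> n" "m \<ge> n" for k m
    proof -
      have "nrm A (step k f \<ominus> step m f)
          \<le> nrm A (step k f \<ominus> step n f) + nrm A (step m f \<ominus> step n f)"
        using nrm_minus_triangle[of "step k f" "step n f" "step m f"]
        by (simp add: nrm_minus_commute)
      also have "\<dots> \<le> e / 3 + e / 3"
        by (intro add_mono nrm_step_diff_le n[THEN spec, THEN spec, THEN mp] that)
      also have "\<dots> < e" using \<open>e > 0\<close> by simp
      finally show ?thesis .
    qed
    then show "\<exists>N. \<forall>m\<ge>N. \<forall>n\<ge>N. nrm A (step m f \<ominus> step n f) < e" by blast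
  qed auto
  then obtain l where "l \<in> carrier A" "(\<lambda>n. nrm A (step n f \<ominus> l)) \<longlonglongrightarrow> 0"
    by blast
  then have "lim (\<lambda>n. step n f) l"
    by (auto simp: lim_def)
  with Phi_eqI[OF this] show ?thesis by simp
qed

lemma Phi_closed [simp]: "cantor_ucont f \<Longrightarrow> Phi f \<in> carrier A"
  using lim_Phi limD by blast

lemma Phi_add:
  "\<lbrakk>cantor_ucont f; cantor_ucont g\<rbrakk> \<Longrightarrow> Phi (\<lambda>x. f x + g x) = Phi f \<oplus> Phi g"
  by (rule Phi_eqI) (simp add: step_add lim_add lim_Phi)

lemma Phi_mult:
  "\<lbrakk>cantor_ucont f; cantor_ucont g\<rbrakk> \<Longrightarrow> Phi (\<lambda>x. f x * g x) = Phi f \<otimes> Phi g"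
  by (rule Phi_eqI) (simp add: step_mult lim_mult lim_Phi)

lemma Phi_minus:
  "\<lbrakk>cantor_ucont f; cantor_ucont g\<rbrakk> \<Longrightarrow> Phi (\<lambda>x. f x - g x) = Phi f \<ominus> Phi g"
  by (rule Phi_eqI)
    (simp add: step_minus a_minus_def uminus_eq_smult lim_add lim_smult lim_Phi)

lemma Phi_smult: "cantor_ucont f \<Longrightarrow> Phi (\<lambda>x. c * f x) = c \<odot> Phi f"
  by (rule Phi_eqI) (simp add: step_smult lim_smult lim_Phi)

lemma Phi_cnj: "cantor_ucont f \<Longrightarrow> Phi (\<lambda>x. cnj (f x)) = star A (Phi f)"
  by (rule Phi_eqI) (simp add: step_cnj lim_star lim_Phi)

lemma Phi_one: "Phi (\<lambda>x. 1) = \<one>"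
  by (rule Phi_eqI) (simp add: step_const lim_const)

lemma Phi_cylinder: "Phi (cylinder_function n x) = word n x \<otimes> star A (word n x)"
proof (rule Phi_eqI)
  show "lim (\<lambda>m. step m (cylinder_function n x)) (word n x \<otimes> star A (word n x))"
  proof (rule limI_bound)
    \<comment> \<open>The approximating sequence is constant from index \<open>n\<close> on, so the
      error bound is the actual distance before \<open>n\<close> and 0 afterwards.\<close>
    show "(\<lambda>m. if m < n then nrm A (step m (cylinder_function n x) \<ominus> word n x \<otimes> star A (word n x)) else 0)
        \<longlonglongrightarrow> 0"
      by (rule tendsto_eventually) (auto intro: eventually_sequentiallyI[of n])
  qed (auto simp: step_cylinder minus_simps)
qed

lemma nrm_Phi_le:
  assumes "cantor_ucont f" "\<And>x. cmod (f x) \<le> M"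
  shows "nrm A (Phi f) \<le> M"
  using lim_nrm[OF lim_Phi[OF assms(1)]]
  by (rule LIMSEQ_le_const2) (auto intro: nrm_step_le assms(2))

text \<open>Truncating \<open>x\<close> after many bits changes \<open>f x\<close> by at most
  \<open>e\<close>, and the truncation is a sample point. Together with \<open>nrm_Phi_le\<close>,
  this makes \<open>Phi\<close> isometric for the supremum norm.\<close>

lemma le_nrm_Phi:
  assumes f: "cantor_ucont f" and "\<one> \<noteq> \<zero>"
  shows "cmod (f x) \<le> nrm A (Phi f)"
proof (rule field_le_epsilon)
  fix e :: real assume "e > 0"
  with f obtain n where n: "\<forall>x y. (\<forall>i<n. x i = y i) \<longrightarrow> cmod (f x - f y) \<le> e"
    unfolding cantor_ucont_def by blast
  have "cmod (f x) \<le> nrm A (step m f) + e" if "m \<ge> n" for m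
  proof -
    let ?y = "\<lambda>i. if i < m then x i else False"
    have "cmod (f x) \<le> cmod (f ?y) + cmod (f x - f ?y)"
      using norm_triangle_ineq[of "f ?y" "f x - f ?y"] by simp
    then show ?thesis
      using le_nrm_step[OF assms(2), of f m x] n[THEN spec, THEN spec, THEN mp, of x ?y] that by force
  qed
  moreover have "(\<lambda>m. nrm A (step m f) + e) \<longlonglongrightarrow> nrm A (Phi f) + e"
    by (intro tendsto_intros lim_nrm lim_Phi f)
  ultimately show "cmod (f x) \<le> nrm A (Phi f) + e"
    by (intro LIMSEQ_le_const) blast+
qed

end

section \<open>Topology of the Cantor space\<close>

lemma open_cylinder: "open {y :: nat \<Rightarrow> bool. \<forall>i<n. y i = x i}"
proof -
  have "{y :: nat \<Rightarrow> bool. \<forall>i<n. y i = x i} = (\<Inter>i\<in>{..<n}. (\<lambda>y. y i) -` {x i})"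
    by auto
  then show ?thesis
    by (auto intro!: open_INT open_vimage open_discrete continuous_on_product_coordinates)
qed

text \<open>A basic open set of the product restricts only finitely many coordinates;
  \<open>n\<close> is any bound for their indices.\<close>

lemma cylinder_subset_open:
  fixes U :: "(nat \<Rightarrow> bool) set"
  assumes "open U" "x \<in> U"
  obtains n where "{y. \<forall>i<n. y i = x i} \<subseteq> U"
proof -
  have "openin (product_topology (\<lambda>i. euclidean) UNIV) U"
    using assms(1) by (simp add: open_fun_def)
  from product_topology_open_contains_basis[OF this assms(2)]
  obtain X where X: "x \<in> Pi\<^sub>E UNIV X" "finite {i. X i \<noteq> UNIV}" "Pi\<^sub>E UNIV X \<subseteq> U"
    by auto
  obtain n where n: "\<And>i. X i \<noteq> UNIV \<Longrightarrow> i < n"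
    using X(2) unfolding finite_nat_set_iff_bounded by auto
  have "y \<in> U" if y: "\<forall>i<n. y i = x i" for y
  proof -
    have "y i \<in> X i" for i
    proof (cases "i < n")
      case True
      then show ?thesis using X(1) y by auto
    next
      case False
      then show ?thesis using n by blast
    qed
    then show ?thesis using X(3) by auto
  qed
  then show ?thesis using that by blast
qed

lemma compact_cantor: "compact (UNIV :: (nat \<Rightarrow> bool) set)"
proof -
  have "compact_space (euclidean :: bool topology)"
    by (simp add: compact_space_def finite_imp_compact)
  then have "compact_space (product_topology (\<lambda>i::nat. euclidean :: bool topology) UNIV)"
    by (simp add: compact_space_product_topology)
  then show ?thesis
    unfolding euclidean_product_topology compact_space_def by simp
qed

text \<open>A Lebesgue number argument: finitely many cylinders on which \<open>f\<close> stays
  within \<open>e / 2\<close> of its value at the centre cover the space, and the largest of their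
  depths works everywhere.\<close>

lemma continuous_imp_cantor_ucont:
  assumes f: "continuous_on UNIV f"
  shows "cantor_ucont f"
  unfolding cantor_ucont_def
proof (intro allI impI)
  fix e :: real assume e: "e > 0"
  have "\<exists>n. {y. \<forall>i<n. y i = x i} \<subseteq> f -` ball (f x) (e / 2)" for x
    by (rule cylinder_subset_open[of "f -` ball (f x) (e / 2)" x])
      (use e f in \<open>auto intro: open_vimage\<close>)
  then obtain N where N: "\<And>x. {y. \<forall>i<N x. y i = x i} \<subseteq> f -` ball (f x) (e / 2)"
    by metis
  have "UNIV \<subseteq> (\<Union>x\<in>UNIV. {y. \<forall>i<N x. y i = x i})" by auto
  then obtain D where D: "finite D" "UNIV \<subseteq> (\<Union>x\<in>D. {y. \<forall>i<N x. y i = x i})"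
    by (rule compactE_image[OF compact_cantor, rotated]) (use open_cylinder in auto)
  have "cmod (f x - f y) \<le> e" if xy: "\<forall>i<Max (N ` D). x i = y i" for x y
  proof -
    obtain z where z: "z \<in> D" "\<forall>i<N z. x i = z i" using D(2) by blast
    have "N z \<le> Max (N ` D)" using z(1) D(1) by simp
    then have "\<forall>i<N z. y i = z i" using z(2) xy by (metis order_less_le_trans)
    then have "dist (f z) (f x) < e / 2" "dist (f z) (f y) < e / 2"
      using N[of z] z(2) unfolding vimage_def mem_ball by blast+
    then have "dist (f x) (f y) < e"
      by (rule dist_triangle_half_r)
    then show ?thesis by (simp add: dist_norm)
  qed
  then show "\<exists>n. \<forall>x y. (\<forall>i<n. x i = y i) \<longrightarrow> cmod (f x - f y) \<le> e" by blast
qed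

text \<open>The function is a finite product of functions of single coordinates, each continuous
  because \<open>bool\<close> is discrete.\<close>

lemma continuous_cylinder_function: "continuous_on UNIV (cylinder_function n x)"
proof -
  have "cylinder_function n x = (\<lambda>y. \<Prod>i<n. (\<lambda>b. if b = x i then 1 else 0) (y i))"
    by (auto simp: cylinder_function_def fun_eq_iff)
  moreover have "continuous_on UNIV (\<lambda>y :: nat \<Rightarrow> bool. (\<lambda>b. if b = x i then 1 else 0 :: complex) (y i))" for i
    by (rule continuous_on_compose2[OF _ continuous_on_product_coordinates])
      (auto simp: continuous_on_open_vimage open_discrete)
  ultimately show ?thesis
    by (simp add: continuous_on_prod)
qed

section \<open>Pointwise operations of the function algebras\<close>

lemma continuous_functions_simps [simp]:
  "carrier (continuous_functions X) = {f \<in> extensional (topspace X). continuous_map X euclidean f}"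
  "f \<otimes>\<^bsub>continuous_functions X\<^esub> g = (\<lambda>x\<in>topspace X. f x * g x)"
  "f \<oplus>\<^bsub>continuous_functions X\<^esub> g = (\<lambda>x\<in>topspace X. f x + g x)"
  "\<one>\<^bsub>continuous_functions X\<^esub> = (\<lambda>x\<in>topspace X. 1)"
  "\<zero>\<^bsub>continuous_functions X\<^esub> = (\<lambda>x\<in>topspace X. 0)"
  "c \<odot>\<^bsub>continuous_functions X\<^esub> f = (\<lambda>x\<in>topspace X. c * f x)"
  "star (continuous_functions X) f = (\<lambda>x\<in>topspace X. cnj (f x))"
  by (simp_all add: continuous_functions_def function_algebra_def)

lemma bounded_functions_simps [simp]:
  "carrier (bounded_functions S) = {f \<in> extensional S. bounded (f ` S)}"
  "f \<otimes>\<^bsub>bounded_functions S\<^esub> g = (\<lambda>x\<in>S. f x * g x)"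
  "f \<oplus>\<^bsub>bounded_functions S\<^esub> g = (\<lambda>x\<in>S. f x + g x)"
  "\<one>\<^bsub>bounded_functions S\<^esub> = (\<lambda>x\<in>S. 1)"
  "\<zero>\<^bsub>bounded_functions S\<^esub> = (\<lambda>x\<in>S. 0)"
  "c \<odot>\<^bsub>bounded_functions S\<^esub> f = (\<lambda>x\<in>S. c * f x)"
  "star (bounded_functions S) f = (\<lambda>x\<in>S. cnj (f x))"
  by (simp_all add: bounded_functions_def function_algebra_def)

section \<open>The diagonal subalgebra as an algebra of continuous functions\<close>

context cuntz_pair
begin

text \<open>The copy of C(X) inside \<open>A\<close>. It lives on the same type as \<open>A\<close>,
  so the functor can be applied both to it and to its inclusion into \<open>A\<close>.\<close>

definition diagonal :: "'a star_algebra" where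
  "diagonal = A\<lparr>carrier := Phi ` {f. continuous_on UNIV f}\<rparr>"

lemma carrier_diagonal: "carrier diagonal = Phi ` {f. continuous_on UNIV f}"
  by (simp add: diagonal_def)

lemma carrier_diagonal_subset: "carrier diagonal \<subseteq> carrier A"
  by (auto simp: carrier_diagonal continuous_imp_cantor_ucont)

text \<open>The lower bound \<open>le_nrm_Phi\<close> turns a norm convergent sequence into a
  uniformly Cauchy sequence of functions. Its uniform limit is continuous, and the upper bound
  \<open>nrm_Phi_le\<close> carries the convergence back to \<open>A\<close>.\<close>

lemma diagonal_closed:
  assumes nz: "\<one> \<noteq> \<zero>" and r: "range r \<subseteq> carrier diagonal" and l: "lim r l"
  shows "l \<in> carrier diagonal"
proof -
  have "\<exists>f. continuous_on UNIV f \<and> r n = Phi f" for n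
    using r by (auto simp: carrier_diagonal)
  then obtain f where f: "\<And>n. continuous_on UNIV (f n)" "\<And>n. r n = Phi (f n)"
    by metis
  note uc = continuous_imp_cantor_ucont[OF f(1)]
  have "uniformly_Cauchy_on UNIV f"
    unfolding uniformly_Cauchy_on_def
  proof (intro allI impI)
    fix e :: real assume e: "e > 0"
    then obtain M where "\<forall>n\<ge>M. norm (nrm A (r n \<ominus> l) - 0) < e / 2"
      using LIMSEQ_D[OF lim_tendsto_nrm[OF l], of "e / 2"] by auto
    then have M: "nrm A (r n \<ominus> l) < e / 2" if "n \<ge> M" for n
      using that by (auto simp: abs_less_iff)
    have "dist (f m x) (f n x) < e" if "m \<ge> M" "n \<ge> M" for m n x
    proof -
      have "dist (f m x) (f n x) \<le> nrm A (Phi (\<lambda>x. f m x - f n x))"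
        unfolding dist_norm
        by (rule le_nrm_Phi[OF _ nz]) (intro continuous_imp_cantor_ucont continuous_intros f)
      also have "\<dots> = nrm A (r m \<ominus> r n)"
        by (simp add: Phi_minus uc f(2))
      also have "\<dots> \<le> nrm A (r m \<ominus> l) + nrm A (r n \<ominus> l)"
        using nrm_minus_triangle[of "r m" l "r n"] l by (simp add: nrm_minus_commute)
      also have "\<dots> < e / 2 + e / 2"
        by (intro add_strict_mono M that)
      finally show ?thesis by simp
    qed
    then show "\<exists>M. \<forall>x\<in>UNIV. \<forall>m\<ge>M. \<forall>n\<ge>M. dist (f m x) (f n x) < e" by blast
  qed
  then obtain g where g: "uniform_limit UNIV f g sequentially"
    using Cauchy_uniformly_convergent by (auto simp: uniformly_convergent_on_def)
  then have cg: "continuous_on UNIV g"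
    by (rule uniform_limit_theorem[rotated]) (use f in auto)
  have "lim r (Phi g)"
    unfolding lim_def
  proof (intro conjI)
    show "(\<lambda>n. nrm A (r n \<ominus> Phi g)) \<longlonglongrightarrow> 0"
    proof (rule LIMSEQ_I)
      fix e :: real assume e: "e > 0"
      then have "\<forall>\<^sub>F n in sequentially. \<forall>x\<in>UNIV. dist (f n x) (g x) < e / 2"
        using uniform_limitD[OF g, of "e / 2"] by simp
      then obtain N where N: "\<And>n x. n \<ge> N \<Longrightarrow> dist (f n x) (g x) < e / 2"
        by (auto simp: eventually_sequentially)
      have "norm (nrm A (r n \<ominus> Phi g) - 0) < e" if "n \<ge> N" for n
      proof -
        have "nrm A (r n \<ominus> Phi g) = nrm A (Phi (\<lambda>x. f n x - g x))"
          by (simp add: f(2) Phi_minus uc continuous_imp_cantor_ucont cg)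
        also have "\<dots> \<le> e / 2"
          using N[OF that]
          by (intro nrm_Phi_le continuous_imp_cantor_ucont continuous_intros f cg)
            (auto simp: dist_norm less_imp_le)
        finally show ?thesis
          using e nrm_nonneg[of "r n \<ominus> Phi g"] l cg by (simp add: continuous_imp_cantor_ucont)
      qed
      then show "\<exists>N. \<forall>n\<ge>N. norm (nrm A (r n \<ominus> Phi g) - 0) < e" by blast
    qed
  qed (use l cg in \<open>auto simp: continuous_imp_cantor_ucont lim_def\<close>)
  then have "l = Phi g" using l lim_unique by blast
  then show ?thesis using cg by (simp add: carrier_diagonal)
qed

lemma cstar_algebra_diagonal:
  assumes "\<one> \<noteq> \<zero>"
  shows "cstar_algebra diagonal"
  unfolding diagonal_def
proof (rule cstar_subalgebra)
  let ?H = "Phi ` {f. continuous_on UNIV f}"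
  have I: "Phi f \<in> ?H" if "continuous_on UNIV f" for f using that by simp
  note uc = continuous_imp_cantor_ucont
  show "cstar_algebra A" by unfold_locales
  show "?H \<subseteq> carrier A"
    using carrier_diagonal_subset by (simp add: carrier_diagonal)
  show "\<one> \<in> ?H"
    using I[of "\<lambda>_. 1"] by (simp add: Phi_one)
  show "x \<oplus> y \<in> ?H" if "x \<in> ?H" "y \<in> ?H" for x y
    using that by (auto simp: Phi_add[symmetric] uc intro!: I continuous_intros)
  show "x \<otimes> y \<in> ?H" if "x \<in> ?H" "y \<in> ?H" for x y
    using that by (auto simp: Phi_mult[symmetric] uc intro!: I continuous_intros)
  show "c \<odot> x \<in> ?H" if "x \<in> ?H" for c x
    using that by (auto simp: Phi_smult[symmetric] uc intro!: I continuous_intros)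
  show "star A x \<in> ?H" if "x \<in> ?H" for x
    using that by (auto simp: Phi_cnj[symmetric] uc intro!: I continuous_intros)
  show "l \<in> ?H" if "range r \<subseteq> ?H" "lim r l" for r l
    using diagonal_closed[OF assms, of r l] that by (simp add: carrier_diagonal)
qed

text \<open>Functions on \<open>Y\<close> are pulled back along \<open>h\<close> and then
  represented by \<open>Phi\<close>. Injectivity comes from \<open>le_nrm_Phi\<close>, surjectivity
  from pulling back along \<open>k\<close>. A general copy \<open>Y\<close> is allowed because the
  hypothesis on the functor concerns topologies on one fixed type.\<close>

lemma diagonal_iso:
  assumes nz: "\<one> \<noteq> \<zero>" and hk: "homeomorphic_maps (euclidean :: (nat \<Rightarrow> bool) topology) Y h k"
  shows "(\<lambda>f\<in>carrier (continuous_functions Y). Phi (\<lambda>x. f (h x)))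
    \<in> star_iso (continuous_functions Y) diagonal" (is "?\<phi> \<in> _")
proof -
  have hY: "h x \<in> topspace Y" for x
    using hk by (auto simp: homeomorphic_maps_def continuous_map_def)
  have kh: "k (h x) = x" for x
    using hk by (simp add: homeomorphic_maps_def)
  have hk': "h (k y) = y" if "y \<in> topspace Y" for y
    using hk that by (simp add: homeomorphic_maps_def)
  have ch: "continuous_on UNIV (\<lambda>x. f (h x))" if "continuous_map Y euclidean f" for f :: "_ \<Rightarrow> complex"
    using continuous_map_compose[of euclidean Y h euclidean f] that hk
    by (simp add: homeomorphic_maps_def o_def)
  note uc = continuous_imp_cantor_ucont[OF ch]
  let ?C = "carrier (continuous_functions Y)"
  have closed: "(\<lambda>y\<in>topspace Y. g y) \<in> ?C" if "continuous_map Y euclidean g" for g :: "_ \<Rightarrow> complex"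
  proof -
    have "continuous_map Y euclidean (\<lambda>y\<in>topspace Y. g y)"
      by (rule continuous_map_eq[OF that]) simp
    then show ?thesis by simp
  qed
  \<comment> \<open>The operations on functions restrict their results to \<open>topspace Y\<close>;
    since \<open>h\<close> maps into this set, the restriction disappears after composition.\<close>
  have eval: "?\<phi> (\<lambda>y\<in>topspace Y. g y) = Phi (\<lambda>x. g (h x))" if "continuous_map Y euclidean g" for g
    using closed[OF that] by (simp add: hY)
  have evalC: "?\<phi> f = Phi (\<lambda>x. f (h x))" if "f \<in> ?C" for f
    using that by simp
  have cont: "continuous_map Y euclidean f" if "f \<in> ?C" for f
    using that by simp
  have cmult: "continuous_map Y euclidean (\<lambda>x. f x * g x)"
    and cadd: "continuous_map Y euclidean (\<lambda>x. f x + g x)"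
    and ccnj: "continuous_map Y euclidean (\<lambda>x. cnj (f x))"
    and cc: "continuous_map Y euclidean (\<lambda>x. c * f x)"
    if "continuous_map Y euclidean f" "continuous_map Y euclidean g" for f g :: "_ \<Rightarrow> complex" and c
    using that unfolding continuous_map_atin by (auto intro!: tendsto_intros)
  have hom: "?\<phi> \<in> star_hom (continuous_functions Y) diagonal"
  proof -
    have "?\<phi> \<in> ring_hom (continuous_functions Y) diagonal"
    proof (rule ring_hom_memI)
      fix f g assume fg: "f \<in> ?C" "g \<in> ?C"
      show "?\<phi> f \<in> carrier diagonal"
        using fg by (simp add: carrier_diagonal ch)
      show "?\<phi> (f \<otimes>\<^bsub>continuous_functions Y\<^esub> g) = ?\<phi> f \<otimes>\<^bsub>diagonal\<^esub> ?\<phi> g"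
        unfolding continuous_functions_simps(2) eval[OF cmult[OF cont[OF fg(1)] cont[OF fg(2)]]]
        using fg by (simp add: diagonal_def Phi_mult uc)
      show "?\<phi> (f \<oplus>\<^bsub>continuous_functions Y\<^esub> g) = ?\<phi> f \<oplus>\<^bsub>diagonal\<^esub> ?\<phi> g"
        unfolding continuous_functions_simps(3) eval[OF cadd[OF cont[OF fg(1)] cont[OF fg(2)]]]
        using fg by (simp add: diagonal_def Phi_add uc)
    next
      show "?\<phi> \<one>\<^bsub>continuous_functions Y\<^esub> = \<one>\<^bsub>diagonal\<^esub>"
        unfolding continuous_functions_simps(4)
        by (subst eval) (auto simp: diagonal_def Phi_one)
    qed
    moreover have "?\<phi> (c \<odot>\<^bsub>continuous_functions Y\<^esub> f) = c \<odot>\<^bsub>diagonal\<^esub> ?\<phi> f" if "f \<in> ?C" for c f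
      unfolding continuous_functions_simps(6) eval[OF cc[OF cont[OF that] cont[OF that]]]
      using that by (simp add: diagonal_def Phi_smult uc)
    moreover have "?\<phi> (star (continuous_functions Y) f) = star diagonal (?\<phi> f)" if "f \<in> ?C" for f
      unfolding continuous_functions_simps(7) eval[OF ccnj[OF cont[OF that] cont[OF that]]]
      using that by (simp add: diagonal_def Phi_cnj uc)
    ultimately show ?thesis
      unfolding star_hom_def by (simp only: mem_Collect_eq Int_iff restrict_extensional) blast
  qed
  have "inj_on ?\<phi> ?C"
  proof (rule inj_onI)
    fix f g assume fg: "f \<in> ?C" "g \<in> ?C" and eq: "?\<phi> f = ?\<phi> g"
    have c: "continuous_on UNIV (\<lambda>x. f (h x))" "continuous_on UNIV (\<lambda>x. g (h x))"
      using fg ch by auto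
    have "Phi (\<lambda>x. f (h x) - g (h x)) = Phi (\<lambda>x. f (h x)) \<ominus> Phi (\<lambda>x. g (h x))"
      using fg by (intro Phi_minus uc) auto
    also have "\<dots> = \<zero>"
      using eq fg c by (simp add: minus_eq_zero_iff continuous_imp_cantor_ucont)
    finally have "cmod (f (h x) - g (h x)) \<le> 0" for x
      using le_nrm_Phi[OF continuous_imp_cantor_ucont nz, of "\<lambda>x. f (h x) - g (h x)" x]
        continuous_on_diff[OF c] by simp
    then have "f (h x) = g (h x)" for x by simp
    then have "f y = g y" if "y \<in> topspace Y" for y using hk'[OF that] by metis
    then show "f = g" using fg by (auto intro: extensionalityI)
  qed
  moreover have "?\<phi> ` ?C = carrier diagonal"
  proof
    show "?\<phi> ` ?C \<subseteq> carrier diagonal"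
      by (auto simp: carrier_diagonal ch)
    show "carrier diagonal \<subseteq> ?\<phi> ` ?C"
    proof
      fix a assume "a \<in> carrier diagonal"
      then obtain g where g: "continuous_on UNIV g" "a = Phi g"
        by (auto simp: carrier_diagonal)
      have "continuous_map Y euclidean (\<lambda>y. g (k y))"
        using continuous_map_compose[of Y euclidean k euclidean g] g hk
        by (simp add: homeomorphic_maps_def o_def)
      from eval[OF this] closed[OF this] show "a \<in> ?\<phi> ` ?C"
        unfolding kh g(2) by (intro image_eqI[of _ _ "\<lambda>y\<in>topspace Y. g (k y)"]) auto
    qed
  qed
  ultimately show ?thesis
    using hom by (auto simp: star_iso_def bij_betw_def)
qed

text \<open>\<open>diagonal_iso\<close> for the identity homeomorphism shows that the function
  algebra of the Cantor space is represented on the type \<open>'a\<close>. Then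
  \<open>compact_Hausdorff_representable\<close> moves the space itself to the type
  \<open>'a \<Rightarrow> complex\<close>.\<close>

lemma diagonal_cantor_model:
  assumes nz: "\<one> \<noteq> \<zero>"
  obtains Y :: "('a \<Rightarrow> complex) topology" and h k where
    "compact_space Y" "Hausdorff_space Y"
    "homeomorphic_maps (euclidean :: (nat \<Rightarrow> bool) topology) Y h k"
proof -
  let ?X = "euclidean :: (nat \<Rightarrow> bool) topology"
  have X: "compact_space ?X" "Hausdorff_space ?X"
  proof -
    show "compact_space ?X" using compact_cantor by (simp add: compact_space_def)
    have "Hausdorff_space (euclidean :: bool topology)"
      unfolding Hausdorff_space_def
    proof (intro allI impI)
      fix x y :: bool
      assume "x \<in> topspace euclidean \<and> y \<in> topspace euclidean \<and> x \<noteq> y"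
      then show "\<exists>U V. openin euclidean U \<and> openin euclidean V \<and> x \<in> U \<and> y \<in> V \<and> disjnt U V"
        by (intro exI[of _ "{x}"] exI[of _ "{y}"]) (simp add: open_discrete)
    qed
    then have "Hausdorff_space (product_topology (\<lambda>i::nat. euclidean :: bool topology) UNIV)"
      by (simp add: Hausdorff_space_product_topology)
    then show "Hausdorff_space ?X" unfolding euclidean_product_topology .
  qed
  have "homeomorphic_maps ?X ?X id id"
    by (simp add: homeomorphic_maps_def)
  from compact_Hausdorff_representable[OF X diagonal_iso[OF nz this]]
  obtain Y :: "('a \<Rightarrow> complex) topology" where Y: "?X homeomorphic_space Y" ..
  then obtain h k where "homeomorphic_maps ?X Y h k"
    by (auto simp: homeomorphic_space_def)
  moreover have "compact_space Y" "Hausdorff_space Y"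
    using Y X homeomorphic_compact_space homeomorphic_Hausdorff_space by blast+
  ultimately show ?thesis using that by blast
qed

end

subsection \<open>Projections in the image of the functor\<close>

lemma star_homD:
  assumes "f \<in> star_hom A B"
  shows "x \<in> carrier A \<Longrightarrow> f x \<in> carrier B"
    and "\<lbrakk>x \<in> carrier A; y \<in> carrier A\<rbrakk> \<Longrightarrow> f (x \<otimes>\<^bsub>A\<^esub> y) = f x \<otimes>\<^bsub>B\<^esub> f y"
    and "\<lbrakk>x \<in> carrier A; y \<in> carrier A\<rbrakk> \<Longrightarrow> f (x \<oplus>\<^bsub>A\<^esub> y) = f x \<oplus>\<^bsub>B\<^esub> f y"
    and "f \<one>\<^bsub>A\<^esub> = \<one>\<^bsub>B\<^esub>"
    and "x \<in> carrier A \<Longrightarrow> f (c \<odot>\<^bsub>A\<^esub> x) = c \<odot>\<^bsub>B\<^esub> f x"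
    and "x \<in> carrier A \<Longrightarrow> f (star A x) = star B (f x)"
  using assms by (auto simp: star_hom_def ring_hom_def)

lemma star_hom_projections:
  assumes "f \<in> star_hom A B" "p \<in> projections A"
  shows "f p \<in> projections B"
  using assms star_homD[OF assms(1)] by (simp add: projections_def) metis

text \<open>The intersections with \<open>projections A\<close> come from \<open>Upper\<close>,
  which tests only members of the carrier.\<close>

lemma is_projection_sup_iff:
  "is_projection_sup A P p \<longleftrightarrow>
    p \<in> projections A \<and> (\<forall>q\<in>P \<inter> projections A. q \<otimes>\<^bsub>A\<^esub> p = q) \<and>
    (\<forall>u\<in>projections A. (\<forall>q\<in>P \<inter> projections A. q \<otimes>\<^bsub>A\<^esub> u = q) \<longrightarrow> p \<otimes>\<^bsub>A\<^esub> u = p)"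
  unfolding is_projection_sup_def least_def Upper_def projection_order_def by auto

context cstar_algebra
begin

lemma one_projection: "\<one> \<in> projections A"
  by (auto simp: projections_def)

lemma complement_projection: "p \<in> projections A \<Longrightarrow> \<one> \<ominus> p \<in> projections A"
  by (simp add: projections_def star_minus) (simp add: minus_simps distrib add_ac)

text \<open>Orthogonality to \<open>p\<close> says that \<open>\<one> \<ominus> p\<close> is an
  upper bound of \<open>Q\<close>. It therefore dominates the supremum \<open>\<one>\<close>, which
  leaves nothing for \<open>p\<close>.\<close>

lemma projection_orthogonal_to_sup:
  assumes Q: "Q \<subseteq> projections A" "is_projection_sup A Q \<one>" and p: "p \<in> projections A"
    and orth: "\<And>q. q \<in> Q \<Longrightarrow> q \<otimes> p = \<zero>"
  shows "p = \<zero>"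
proof -
  have pc: "p \<in> carrier A" using p by (simp add: projections_def)
  have "q \<otimes> (\<one> \<ominus> p) = q" if "q \<in> Q" for q
  proof -
    have "q \<in> carrier A" using that Q(1) by (auto simp: projections_def)
    then show ?thesis using pc orth[OF that] by (simp add: minus_simps distrib)
  qed
  then have "\<one> \<otimes> (\<one> \<ominus> p) = \<one>"
    using Q(2) complement_projection[OF p] unfolding is_projection_sup_iff by blast
  then have "\<one> \<ominus> (\<one> \<ominus> p) = \<zero>"
    using pc by (simp add: minus_eq_zero_iff)
  then show ?thesis using pc by (simp add: minus_simps)
qed

lemma nrm_mult_le_1:
  assumes "x \<in> carrier A" "y \<in> carrier A" "nrm A x \<le> 1" "nrm A y \<le> 1"
  shows "nrm A (x \<otimes> y) \<le> 1"
  using nrm_mult[of x y] mult_mono[of "nrm A x" 1 "nrm A y" 1] nrm_nonneg assms by fastforce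

lemma carrier_trivial:
  assumes "\<one> = \<zero>"
  shows "carrier A = {\<zero>}"
proof -
  have "x = \<zero>" if "x \<in> carrier A" for x
    using that ring.ring_simprules(12)[OF ring_A that] ring.ring_simprules(24)[OF ring_A that] assms
    by simp
  then show ?thesis by auto
qed

text \<open>The \<open>d y\<close> are the preimages of the indicators of points. An upper bound of
  all of them has value 1 at each point, hence is \<open>\<one>\<close>; and multiplying the
  indicator of \<open>y\<close> by a function sees only its value at \<open>y\<close>.\<close>

lemma bounded_functions_atoms:
  assumes \<psi>: "\<psi> \<in> star_iso A (bounded_functions S)"
  obtains d where "\<And>y. y \<in> S \<Longrightarrow> d y \<in> projections A"
    and "is_projection_sup A (d ` S) \<one>"
    and "\<And>a y. \<lbrakk>a \<in> carrier A; y \<in> S; \<psi> a y = 1\<rbrakk> \<Longrightarrow> a \<otimes> d y = d y"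
proof -
  have hom: "\<psi> \<in> star_hom A (bounded_functions S)"
    and inj: "inj_on \<psi> (carrier A)" and surj: "\<psi> ` carrier A = carrier (bounded_functions S)"
    using \<psi> by (auto simp: star_iso_def bij_betw_def)
  note h = star_homD[OF hom]
  define d where "d y = inv_into (carrier A) \<psi> (\<lambda>x\<in>S. if x = y then 1 else 0)" for y
  have "bounded ((\<lambda>x\<in>S. if x = y then 1 else 0 :: complex) ` S)" for y
    by (rule boundedI[where B = 1]) auto
  then have mem: "(\<lambda>x\<in>S. if x = y then 1 else 0) \<in> \<psi> ` carrier A" for y
    unfolding surj by simp
  have dc: "d y \<in> carrier A" for y
    unfolding d_def by (rule inv_into_into[OF mem])
  have \<psi>d: "\<psi> (d y) = (\<lambda>x\<in>S. if x = y then 1 else 0)" for y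
    unfolding d_def by (rule f_inv_into_f[OF mem])
  have eqI: "a = b" if "a \<in> carrier A" "b \<in> carrier A" "\<And>x. x \<in> S \<Longrightarrow> \<psi> a x = \<psi> b x" for a b
  proof (rule inj_onD[OF inj])
    show "\<psi> a = \<psi> b"
      using h(1)[OF that(1)] h(1)[OF that(2)] that(3) by (auto intro: extensionalityI)
  qed (use that in auto)
  have dp: "d y \<in> projections A" for y
    unfolding projections_def using dc
    by (auto intro!: eqI simp: h \<psi>d)
  have act: "a \<otimes> d y = d y" if "a \<in> carrier A" "\<psi> a y = 1" for a y
    using that dc by (intro eqI) (auto simp: h \<psi>d)
  have "\<one> \<otimes> u = \<one>" if u: "u \<in> projections A" "\<And>y. y \<in> S \<Longrightarrow> d y \<otimes> u = d y" for u
  proof (rule eqI)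
    have uc: "u \<in> carrier A" using u(1) by (simp add: projections_def)
    show "\<psi> (\<one> \<otimes> u) x = \<psi> \<one> x" if x: "x \<in> S" for x
    proof -
      have "\<psi> (d x \<otimes> u) x = \<psi> (d x) x" using u(2)[OF x] by simp
      then show ?thesis using x uc dc by (simp add: h \<psi>d)
    qed
  qed (use u in \<open>auto simp: projections_def\<close>)
  then have "is_projection_sup A (d ` S) \<one>"
    unfolding is_projection_sup_iff using dp dc by (auto simp: one_projection)
  with dp act show ?thesis using that by blast
qed

end

context natural_star_homs
begin

text \<open>The atoms over the points of the Cantor space are pushed into \<open>Fobj A\<close> by
  the image of the inclusion of \<open>diagonal\<close>. Here the preservation of suprema keeps
  their supremum equal to one, and naturality identifies what acts on them.\<close>

lemma cuntz_pair_eigenprojections: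
  assumes disc: "discretizes_continuous_functions Fobj \<eta>"
    and cp: "cuntz_pair A s" and nz: "\<one>\<^bsub>A\<^esub> \<noteq> \<zero>\<^bsub>A\<^esub>"
  obtains P where "P \<subseteq> projections (Fobj A)" "is_projection_sup (Fobj A) P \<one>\<^bsub>Fobj A\<^esub>"
    "\<And>p. p \<in> P \<Longrightarrow> \<exists>x. \<forall>n. \<eta> A (cuntz_pair.word A s n x \<otimes>\<^bsub>A\<^esub>
        star A (cuntz_pair.word A s n x)) \<otimes>\<^bsub>Fobj A\<^esub> p = p"
proof -
  interpret cuntz_pair A s by fact
  have A: "cstar_algebra A" by unfold_locales
  have D: "cstar_algebra diagonal" by (rule cstar_algebra_diagonal[OF nz])
  obtain Y :: "('u \<Rightarrow> complex) topology" and h k where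
    Y: "compact_space Y" "Hausdorff_space Y"
    and hk: "homeomorphic_maps (euclidean :: (nat \<Rightarrow> bool) topology) Y h k"
    by (rule diagonal_cantor_model[OF nz])
  define \<phi> where "\<phi> = (\<lambda>f\<in>carrier (continuous_functions Y). Phi (\<lambda>x. f (h x)))"
  have \<phi>: "\<phi> \<in> star_iso (continuous_functions Y) diagonal"
    unfolding \<phi>_def by (rule diagonal_iso[OF nz hk])
  obtain \<psi> where \<psi>: "\<psi> \<in> star_iso (Fobj diagonal) (bounded_functions (topspace Y))"
    and \<psi>\<eta>: "\<And>f. f \<in> carrier (continuous_functions Y) \<Longrightarrow> \<psi> (\<eta> diagonal (\<phi> f)) = f"
    using disc Y D \<phi> unfolding discretizes_continuous_functions_def by blast
  interpret FD: awstar_algebra "Fobj diagonal" by (rule obj[OF D])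
  obtain d where d: "\<And>y. y \<in> topspace Y \<Longrightarrow> d y \<in> projections (Fobj diagonal)"
    "is_projection_sup (Fobj diagonal) (d ` topspace Y) \<one>\<^bsub>Fobj diagonal\<^esub>"
    "\<And>a y. \<lbrakk>a \<in> carrier (Fobj diagonal); y \<in> topspace Y; \<psi> a y = 1\<rbrakk>
      \<Longrightarrow> a \<otimes>\<^bsub>Fobj diagonal\<^esub> d y = d y"
    by (rule FD.bounded_functions_atoms[OF \<psi>]) blast
  \<comment> \<open>The inclusion of the subalgebra, restricted to its carrier because morphisms are
    extensional.\<close>
  define \<iota> where "\<iota> = (\<lambda>x\<in>carrier diagonal. x)"
  have \<iota>: "\<iota> \<in> star_hom diagonal A"
    using carrier_diagonal_subset cstar_algebra.star_closed[OF D] ring.ring_simprules[OF cstar_algebra.ring_A[OF D]]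
      cstar_algebra.smult_in_carrier[OF D]
    by (auto simp: star_hom_def ring_hom_def \<iota>_def diagonal_def)
  define g where "g = Fmap diagonal A \<iota>"
  have g: "g \<in> aw_hom (Fobj diagonal) (Fobj A)"
    unfolding g_def by (rule map[OF D A \<iota>])
  then have gh: "g \<in> star_hom (Fobj diagonal) (Fobj A)"
    by (simp add: aw_hom_def)
  show ?thesis
  proof (rule that[of "(g \<circ> d) ` topspace Y"])
    show "(g \<circ> d) ` topspace Y \<subseteq> projections (Fobj A)"
      using d(1) star_hom_projections[OF gh] by auto
    have "d ` topspace Y \<subseteq> projections (Fobj diagonal)" using d(1) by blast
    then have "is_projection_sup (Fobj A) (g ` d ` topspace Y) (g \<one>\<^bsub>Fobj diagonal\<^esub>)"
      using g d(2) unfolding aw_hom_def by blast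
    then show "is_projection_sup (Fobj A) ((g \<circ> d) ` topspace Y) \<one>\<^bsub>Fobj A\<^esub>"
      by (simp add: star_homD(4)[OF gh] image_comp)
    fix p assume "p \<in> (g \<circ> d) ` topspace Y"
    then obtain y where y: "y \<in> topspace Y" "p = g (d y)" by auto
    \<comment> \<open>The required sequence is \<open>k y\<close>, the point of the Cantor space
      that corresponds to \<open>y\<close>. Its cylinder functions have value 1 there, so they fix
      the atom \<open>d y\<close>.\<close>
    have "\<eta> A (word n (k y) \<otimes>\<^bsub>A\<^esub> star A (word n (k y))) \<otimes>\<^bsub>Fobj A\<^esub> p = p" for n
    proof -
      let ?c = "cylinder_function n (k y)"
      let ?f = "\<lambda>z\<in>topspace Y. ?c (k z)"
      have cont: "continuous_map Y euclidean (\<lambda>z. ?c (k z))"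
        using continuous_map_compose[of Y euclidean k euclidean ?c] hk continuous_cylinder_function
        by (simp add: homeomorphic_maps_def o_def)
      have "continuous_map Y euclidean ?f"
        by (rule continuous_map_eq[OF cont]) simp
      then have f: "?f \<in> carrier (continuous_functions Y)"
        by simp
      have "h x \<in> topspace Y" "k (h x) = x" for x
        using hk by (auto simp: homeomorphic_maps_def continuous_map_def)
      then have \<phi>f: "\<phi> ?f = Phi ?c"
        using f by (simp add: \<phi>_def)
      have \<phi>D: "\<phi> ?f \<in> carrier diagonal"
        using star_homD(1)[OF _ f] \<phi> unfolding star_iso_def by blast
      let ?e = "\<eta> diagonal (\<phi> ?f)"
      have e: "?e \<in> carrier (Fobj diagonal)"
        by (rule star_homD(1)[OF component[OF D] \<phi>D])
      have "?e \<otimes>\<^bsub>Fobj diagonal\<^esub> d y = d y"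
        using d(3)[OF e y(1)] \<psi>\<eta>[OF f] y(1) by (simp add: cylinder_function_def)
      then have "g ?e \<otimes>\<^bsub>Fobj A\<^esub> p = p"
        using star_homD(2)[OF gh e, of "d y"] d(1)[OF y(1)] y(2) by (simp add: projections_def)
      \<comment> \<open>Naturality for the inclusion replaces the component of \<eta> at
        \<open>diagonal\<close> by the one at \<open>A\<close>.\<close>
      moreover have "g ?e = \<eta> A (\<phi> ?f)"
        using fun_cong[OF natural[OF D A \<iota>], of "\<phi> ?f"] \<phi>D by (simp add: compose_def g_def \<iota>_def)
      ultimately show ?thesis by (simp add: \<phi>f Phi_cylinder)
    qed
    then show "\<exists>x. \<forall>n. \<eta> A (word n x \<otimes>\<^bsub>A\<^esub> star A (word n x)) \<otimes>\<^bsub>Fobj A\<^esub> p = p" by blast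
  qed
qed

end

section \<open>The rotated Cuntz pair\<close>

context cuntz_pair
begin

text \<open>The pair rotated by the normalized Hadamard matrix; \<open>True\<close> stands for the
  plus sign and \<open>False\<close> for the minus sign.\<close>

definition hadamard :: "bool \<Rightarrow> 'a" where
  "hadamard b = complex_of_real (1 / sqrt 2) \<odot> (s False \<oplus> (if b then 1 else - 1) \<odot> s True)"

lemma hadamard_closed [simp]: "hadamard b \<in> carrier A"
  by (simp add: hadamard_def)

lemma star_hadamard: "star A (hadamard b) = complex_of_real (1 / sqrt 2) \<odot>
    (star A (s False) \<oplus> (if b then 1 else - 1) \<odot> star A (s True))"
  by (simp add: hadamard_def star_smult star_add)

lemma half: "complex_of_real (1 / sqrt 2) * complex_of_real (1 / sqrt 2) = 1 / 2"
  by (simp flip: of_real_mult)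

text \<open>The scalars are the entries of the Hadamard matrix. Their common modulus
  \<open>1 / sqrt 2\<close> is what makes the two pairs mutually unbiased.\<close>

lemma star_hadamard_s: "star A (hadamard b) \<otimes> s c
    = ((if b \<or> \<not> c then 1 else - 1) * complex_of_real (1 / sqrt 2)) \<odot> \<one>"
  by (simp add: star_hadamard smult_mult_left distrib star_s_s smult_smult mult.commute)

lemma cuntz_pair_hadamard: "cuntz_pair A hadamard"
proof unfold_locales
  let ?r = "complex_of_real (1 / sqrt 2)"
  show "star A (hadamard b) \<otimes> hadamard c = (if b = c then \<one> else \<zero>)" for b c
  proof -
    \<comment> \<open>With the signs \<open>e\<close> and \<open>d\<close> the product becomes half
      of \<open>1 + e * d\<close>, which is 1 for equal signs and 0 for opposite ones.\<close>
    define e :: complex where "e = (if c then 1 else - 1)"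
    define d :: complex where "d = (if b then 1 else - 1)"
    have comb: "r \<odot> (r \<odot> \<one> \<oplus> e \<odot> ((d * r) \<odot> \<one>)) = (r * r * (1 + e * d)) \<odot> \<one>" for r
      by (simp add: smult_smult smult_add_left[symmetric] algebra_simps)
    have "star A (hadamard b) \<otimes> hadamard c
        = ?r \<odot> (star A (hadamard b) \<otimes> s False \<oplus> e \<odot> (star A (hadamard b) \<otimes> s True))"
      unfolding hadamard_def[of c] e_def[symmetric] by (simp add: smult_mult_right distrib)
    also have "star A (hadamard b) \<otimes> s False = ?r \<odot> \<one>"
      unfolding star_hadamard_s by simp
    also have "star A (hadamard b) \<otimes> s True = (d * ?r) \<odot> \<one>"
      unfolding star_hadamard_s d_def by simp
    also have "?r \<odot> (?r \<odot> \<one> \<oplus> e \<odot> ((d * ?r) \<odot> \<one>)) = (?r * ?r * (1 + e * d)) \<odot> \<one>"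
      by (rule comb)
    also have "?r * ?r * (1 + e * d) = (if b = c then 1 else 0)"
      unfolding half d_def e_def by simp
    finally show ?thesis by simp
  qed
  \<comment> \<open>\<open>p\<close> collects the unmixed products and \<open>q\<close> the mixed
    ones. The mixed part enters with opposite signs for the two indices and cancels in the
    sum.\<close>
  define p q where "p = s False \<otimes> star A (s False) \<oplus> s True \<otimes> star A (s True)"
    and "q = s False \<otimes> star A (s True) \<oplus> s True \<otimes> star A (s False)"
  have [simp]: "p \<in> carrier A" "q \<in> carrier A"
    by (simp_all add: p_def q_def)
  have "hadamard b \<otimes> star A (hadamard b) = (1 / 2) \<odot> (p \<oplus> (if b then 1 else - 1) \<odot> q)" for b
    unfolding star_hadamard unfolding hadamard_def half[symmetric]
    by (simp add: p_def q_def distrib smult_mult_left smult_mult_right smult_smult smult_add_right add_ac)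
  then have "hadamard False \<otimes> star A (hadamard False) \<oplus> hadamard True \<otimes> star A (hadamard True)
      = (1 / 2) \<odot> ((p \<oplus> (- 1) \<odot> q) \<oplus> (p \<oplus> 1 \<odot> q))"
    by (simp add: smult_add_right)
  also have "(p \<oplus> (- 1) \<odot> q) \<oplus> (p \<oplus> 1 \<odot> q) = (p \<oplus> p) \<oplus> (((- 1) \<odot> q) \<oplus> (1 \<odot> q))"
    by (simp add: add_ac)
  also have "((- 1) \<odot> q) \<oplus> (1 \<odot> q) = \<zero>"
    using smult_add_left[of q "- 1" 1] by simp
  also have "(1 / 2) \<odot> ((p \<oplus> p) \<oplus> \<zero>) = p"
    using smult_add_left[of p "1 / 2" "1 / 2"] by (simp add: smult_add_right)
  finally show "hadamard False \<otimes> star A (hadamard False) \<oplus> hadamard True \<otimes> star A (hadamard True) = \<one>"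
    by (simp add: p_def s_complete)
qed (rule hadamard_closed)

text \<open>The first letters of both words meet in the middle of the product and give a scalar of
  modulus \<open>1 / sqrt 2\<close>. Pulling it out leaves the same expression for the shorter
  words.\<close>

lemma star_hadamard_word_word:
  "\<exists>c. cmod c = (1 / sqrt 2) ^ n \<and> star A (cuntz_pair.word A hadamard n y) \<otimes> word n x = c \<odot> \<one>"
proof -
  interpret T: cuntz_pair A hadamard by (rule cuntz_pair_hadamard)
  show ?thesis
  proof (induction n arbitrary: x y)
    case 0
    then show ?case by (intro exI[of _ 1]) simp
  next
    case (Suc n)
    obtain c where c: "cmod c = (1 / sqrt 2) ^ n"
      "star A (T.word n (\<lambda>i. y (Suc i))) \<otimes> word n (\<lambda>i. x (Suc i)) = c \<odot> \<one>"
      using Suc.IH by blast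
    define d where "d = (if y 0 \<or> \<not> x 0 then 1 else - 1) * complex_of_real (1 / sqrt 2)"
    have "star A (hadamard (y 0)) \<otimes> s (x 0) = d \<odot> \<one>"
      by (simp only: star_hadamard_s d_def)
    then have d: "star A (hadamard (y 0)) \<otimes> (s (x 0) \<otimes> z) = d \<odot> z" if "z \<in> carrier A" for z
      using that mult_assoc[of "star A (hadamard (y 0))" "s (x 0)" z] by (simp add: smult_mult_left)
    have "star A (T.word (Suc n) y) \<otimes> word (Suc n) x = (d * c) \<odot> \<one>"
      by (simp add: star_mult mult_assoc d smult_mult_right c(2) smult_smult)
    moreover have "cmod d = 1 / sqrt 2"
      by (simp add: d_def norm_mult norm_divide)
    ultimately show ?case
      using c(1) by (intro exI[of _ "d * c"]) (simp add: norm_mult)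
  qed
qed

end

lemma (in natural_star_homs) cuntz_pair_trivial:
  assumes disc: "discretizes_continuous_functions Fobj \<eta>"
    and cp: "cuntz_pair A s" and nz: "\<one>\<^bsub>A\<^esub> \<noteq> \<zero>\<^bsub>A\<^esub>"
  shows "carrier (Fobj A) = {\<zero>\<^bsub>Fobj A\<^esub>}"
proof -
  interpret S: cuntz_pair A s by fact
  interpret T: cuntz_pair A S.hadamard by (rule S.cuntz_pair_hadamard)
  have A: "cstar_algebra A" by unfold_locales
  interpret F: awstar_algebra "Fobj A" by (rule obj[OF A])
  note h = star_homD[OF component[OF A]]
  obtain P where P: "P \<subseteq> projections (Fobj A)" "is_projection_sup (Fobj A) P \<one>\<^bsub>Fobj A\<^esub>"
    "\<And>p. p \<in> P \<Longrightarrow> \<exists>x. \<forall>n. \<eta> A (S.word n x \<otimes>\<^bsub>A\<^esub> star A (S.word n x)) \<otimes>\<^bsub>Fobj A\<^esub> p = p"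
    by (rule cuntz_pair_eigenprojections[OF disc cp nz]) blast
  obtain Q where Q: "Q \<subseteq> projections (Fobj A)" "is_projection_sup (Fobj A) Q \<one>\<^bsub>Fobj A\<^esub>"
    "\<And>p. p \<in> Q \<Longrightarrow> \<exists>x. \<forall>n. \<eta> A (T.word n x \<otimes>\<^bsub>A\<^esub> star A (T.word n x)) \<otimes>\<^bsub>Fobj A\<^esub> p = p"
    by (rule cuntz_pair_eigenprojections[OF disc S.cuntz_pair_hadamard nz]) blast
  have orth: "q \<otimes>\<^bsub>Fobj A\<^esub> p = \<zero>\<^bsub>Fobj A\<^esub>" if p: "p \<in> P" and q: "q \<in> Q" for p q
  proof -
    have pq: "p \<in> projections (Fobj A)" "q \<in> projections (Fobj A)" using p q P(1) Q(1) by auto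
    then have pqc: "p \<in> carrier (Fobj A)" "q \<in> carrier (Fobj A)" by (auto simp: projections_def)
    obtain x where x: "\<And>n. \<eta> A (S.word n x \<otimes>\<^bsub>A\<^esub> star A (S.word n x)) \<otimes>\<^bsub>Fobj A\<^esub> p = p"
      using P(3)[OF p] by blast
    obtain y where y: "\<And>n. \<eta> A (T.word n y \<otimes>\<^bsub>A\<^esub> star A (T.word n y)) \<otimes>\<^bsub>Fobj A\<^esub> q = q"
      using Q(3)[OF q] by blast
    have "nrm (Fobj A) (q \<otimes>\<^bsub>Fobj A\<^esub> p) \<le> (1 / sqrt 2) ^ n" for n
    proof -
      let ?v = "T.word n y" and ?w = "S.word n x"
      let ?v' = "\<eta> A ?v" and ?w' = "\<eta> A ?w"
      have c: "?v' \<in> carrier (Fobj A)" "?w' \<in> carrier (Fobj A)" by (auto intro: h(1))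
      have nv: "nrm (Fobj A) ?v' \<le> 1" "nrm (Fobj A) ?w' \<le> 1"
        using c by (auto intro!: F.nrm_isometry_le
          simp: h(6)[symmetric] h(2)[symmetric] S.star_word_word T.star_word_word h(4))
      obtain k where k: "cmod k = (1 / sqrt 2) ^ n" "star A ?v \<otimes>\<^bsub>A\<^esub> ?w = k \<odot>\<^bsub>A\<^esub> \<one>\<^bsub>A\<^esub>"
        using S.star_hadamard_word_word by blast
      have "star (Fobj A) ?v' \<otimes>\<^bsub>Fobj A\<^esub> ?w' = k \<odot>\<^bsub>Fobj A\<^esub> \<one>\<^bsub>Fobj A\<^esub>"
        by (simp add: h(6)[symmetric] h(2)[symmetric] k(2) h(5) h(4))
      then have vw: "star (Fobj A) ?v' \<otimes>\<^bsub>Fobj A\<^esub> (?w' \<otimes>\<^bsub>Fobj A\<^esub> z) = k \<odot>\<^bsub>Fobj A\<^esub> z"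
        if "z \<in> carrier (Fobj A)" for z
        using F.mult_assoc[of "star (Fobj A) ?v'" ?w' z] that c by (simp add: F.smult_mult_left)
      have p': "p = ?w' \<otimes>\<^bsub>Fobj A\<^esub> (star (Fobj A) ?w' \<otimes>\<^bsub>Fobj A\<^esub> p)"
        using x[of n] pqc c by (simp add: h(2) h(6) F.mult_assoc)
      text \<open>Insert \<open>w w\<^sup>*\<close> next to \<open>p\<close> and \<open>v v\<^sup>*\<close> next to \<open>q\<close>: the factor
        \<open>v\<^sup>* w\<close> in the middle is the scalar \<open>k\<close>.\<close>
      have "q = ?v' \<otimes>\<^bsub>Fobj A\<^esub> star (Fobj A) ?v' \<otimes>\<^bsub>Fobj A\<^esub> q"
        using y[of n] by (simp add: h(2) h(6))
      \<comment> \<open>As \<open>q\<close> is self-adjoint, taking adjoints moves the absorbed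
        range projection from its left side to its right side.\<close>
      then have "star (Fobj A) q
          = star (Fobj A) (?v' \<otimes>\<^bsub>Fobj A\<^esub> star (Fobj A) ?v' \<otimes>\<^bsub>Fobj A\<^esub> q)"
        by simp
      then have q': "q = q \<otimes>\<^bsub>Fobj A\<^esub> ?v' \<otimes>\<^bsub>Fobj A\<^esub> star (Fobj A) ?v'"
        using pq pqc c by (simp add: projections_def F.star_mult F.mult_assoc)
      let ?z = "q \<otimes>\<^bsub>Fobj A\<^esub> ?v'" and ?u = "star (Fobj A) ?w' \<otimes>\<^bsub>Fobj A\<^esub> p"
      have "q \<otimes>\<^bsub>Fobj A\<^esub> p = ?z \<otimes>\<^bsub>Fobj A\<^esub> star (Fobj A) ?v' \<otimes>\<^bsub>Fobj A\<^esub> (?w' \<otimes>\<^bsub>Fobj A\<^esub> ?u)"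
        using p' q' by simp
      also have "\<dots> = k \<odot>\<^bsub>Fobj A\<^esub> (?z \<otimes>\<^bsub>Fobj A\<^esub> ?u)"
        using pqc c by (simp add: F.mult_assoc vw F.smult_mult_right)
      finally have "nrm (Fobj A) (q \<otimes>\<^bsub>Fobj A\<^esub> p)
          = (1 / sqrt 2) ^ n * nrm (Fobj A) (?z \<otimes>\<^bsub>Fobj A\<^esub> ?u)"
        using pqc c by (simp add: F.nrm_smult k(1))
      also have "nrm (Fobj A) (?z \<otimes>\<^bsub>Fobj A\<^esub> ?u) \<le> 1"
        using pq pqc c nv by (intro F.nrm_mult_le_1) (auto simp: F.nrm_projection_le)
      finally show ?thesis by (simp add: mult_left_le)
    qed
    moreover have "(\<lambda>n. (1 / sqrt 2) ^ n) \<longlonglongrightarrow> (0 :: real)"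
      by (intro LIMSEQ_realpow_zero) (auto simp: real_less_rsqrt)
    ultimately have "nrm (Fobj A) (q \<otimes>\<^bsub>Fobj A\<^esub> p) \<le> 0"
      by (intro LIMSEQ_le_const) auto
    then show ?thesis
      using F.nrm_nonneg[of "q \<otimes>\<^bsub>Fobj A\<^esub> p"] F.nrm_eq_0[of "q \<otimes>\<^bsub>Fobj A\<^esub> p"] pqc by simp
  qed
  have "p = \<zero>\<^bsub>Fobj A\<^esub>" if p: "p \<in> P" for p
    using F.projection_orthogonal_to_sup[OF Q(1,2), of p] P(1) orth p by blast
  \<comment> \<open>Now every member of \<open>P\<close> is zero and thus orthogonal to the unit
    itself, so the same lemma applies to \<open>P\<close> and the unit.\<close>
  then have "\<one>\<^bsub>Fobj A\<^esub> = \<zero>\<^bsub>Fobj A\<^esub>"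
    using F.projection_orthogonal_to_sup[OF P(1,2) F.one_projection] F.zero_closed
    by (metis F.r_one)
  then show ?thesis by (rule F.carrier_trivial)
qed

subsection \<open>Isometries of an infinite-dimensional Hilbert space\<close>

text \<open>Cauchy criterion for unordered sums. Partial sums over sets containing \<open>F0\<close>
  differ from the sum over \<open>F0\<close> by a tail, so they form a Cauchy filter, which
  converges in a Banach space.\<close>

lemma summable_on_Cauchy:
  fixes f :: "'i \<Rightarrow> 'b :: banach"
  assumes "\<And>e. e > 0 \<Longrightarrow> \<exists>F0. finite F0 \<and> F0 \<subseteq> I \<and>
    (\<forall>F. finite F \<and> F \<subseteq> I \<and> F \<inter> F0 = {} \<longrightarrow> norm (sum f F) \<le> e)"
  shows "f summable_on I"
proof -
  have "\<exists>P. eventually P (finite_subsets_at_top I) \<and>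
      (\<forall>F F'. P F \<and> P F' \<longrightarrow> dist (sum f F) (sum f F') < e)" if "e > 0" for e
  proof -
    from that have "e / 3 > 0" by simp
    then obtain F0 where F0: "finite F0" "F0 \<subseteq> I"
      "\<And>F. \<lbrakk>finite F; F \<subseteq> I; F \<inter> F0 = {}\<rbrakk> \<Longrightarrow> norm (sum f F) \<le> e / 3"
      using assms by meson
    define P where "P F \<longleftrightarrow> finite F \<and> F0 \<subseteq> F \<and> F \<subseteq> I" for F
    have "eventually P (finite_subsets_at_top I)"
      unfolding eventually_finite_subsets_at_top P_def using F0 by blast
    moreover have "dist (sum f F) (sum f F') < e" if "P F" "P F'" for F F'
    proof -
      have *: "norm (sum f F - sum f F0) \<le> e / 3" if "P F" for F
        using that F0(3)[of "F - F0"] unfolding P_def by (auto simp: sum_diff)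
      have "dist (sum f F) (sum f F') \<le> norm (sum f F - sum f F0) + norm (sum f F' - sum f F0)"
        using dist_triangle2[of "sum f F" "sum f F'" "sum f F0"] by (simp add: dist_norm)
      also have "\<dots> \<le> e / 3 + e / 3" using * that by (intro add_mono) auto
      also have "\<dots> < e" using \<open>e > 0\<close> by simp
      finally show ?thesis .
    qed
    ultimately show ?thesis by blast
  qed
  then have "cauchy_filter (filtermap (sum f) (finite_subsets_at_top I))"
    by (simp add: cauchy_filter_metric_filtermap)
  then obtain L where "(sum f \<longlongrightarrow> L) (finite_subsets_at_top I)"
    unfolding filterlim_def
    using cauchy_filter_complete_converges[of "filtermap (sum f) (finite_subsets_at_top I)" UNIV]
    by (auto simp: filtermap_bot_iff complete_UNIV)
  then show ?thesis
    by (auto simp: summable_on_def has_sum_def)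
qed

section \<open>Inner products and orthonormal families\<close>

text \<open>Makes the theory of linear spans available for \<open>scaleC\<close>;
  \<open>infinite_dimensional\<close> is stated in terms of such spans.\<close>

lemma vector_space_scaleC: "vector_space (scaleC :: complex \<Rightarrow> 'k \<Rightarrow> 'k::chilbert_space)"
proof
  show "scaleC 1 x = x" for x :: 'k
    using scaleC_of_real[of 1 x] by simp
qed (auto simp: scaleC_add_right scaleC_add_left scaleC_scaleC)

interpretation scaleC: vector_space "scaleC :: complex \<Rightarrow> 'k \<Rightarrow> 'k::chilbert_space"
  by (rule vector_space_scaleC)

lemma cinner_add_left: "cinner (x + y) z = cinner x z + cinner y (z :: 'k::chilbert_space)"
  by (metis cinner_add_right cinner_commute complex_cnj_add)

lemma cinner_scaleC_left: "cinner (scaleC c x) y = cnj c * cinner x (y :: 'k::chilbert_space)"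
  by (metis cinner_scaleC_right cinner_commute complex_cnj_mult)

lemma cinner_zero_right [simp]: "cinner x 0 = 0"
  using cinner_scaleC_right[of x 0 0] by simp

lemma cinner_zero_left [simp]: "cinner 0 x = 0"
  using cinner_scaleC_left[of 0 0 x] by simp

lemma cinner_minus_right: "cinner x (- y) = - cinner x y"
  using cinner_add_right[of x y "- y"] by (simp add: eq_neg_iff_add_eq_0 add.commute)

lemma cinner_diff_right: "cinner x (y - z) = cinner x y - cinner x z"
  using cinner_add_right[of x y "- z"] by (simp add: cinner_minus_right)

lemma cinner_diff_left: "cinner (x - y) z = cinner x z - cinner y z"
  by (metis cinner_diff_right cinner_commute complex_cnj_diff)

lemma cinner_sum_right: "cinner x (sum f F) = (\<Sum>i\<in>F. cinner x (f i))"
  by (induction F rule: infinite_finite_induct) (auto simp: cinner_add_right)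

lemma norm_sq_cinner: "(norm x)\<^sup>2 = Re (cinner x x)"
  by (simp add: cinner_self)

lemma cinner_eq_zero_iff [simp]: "cinner x x = 0 \<longleftrightarrow> x = 0"
  by (simp add: cinner_self)

lemma cinner_ext: "(\<And>x. cinner x y = cinner x z) \<Longrightarrow> y = z"
  using cinner_eq_zero_iff[of "y - z"] by (simp add: cinner_diff_right del: cinner_eq_zero_iff)

lemma norm_scaleC: "norm (scaleC c x) = cmod c * norm (x :: 'k::chilbert_space)"
proof -
  have "complex_of_real ((norm (scaleC c x))\<^sup>2) = of_real ((cmod c)\<^sup>2) * of_real ((norm x)\<^sup>2)"
    unfolding cinner_self[symmetric] cinner_scaleC_left cinner_scaleC_right complex_norm_square
    by (simp add: ac_simps)
  then have "(norm (scaleC c x))\<^sup>2 = (cmod c * norm x)\<^sup>2"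
    unfolding of_real_mult[symmetric] of_real_eq_iff power_mult_distrib .
  then show ?thesis by (simp add: power2_eq_iff_nonneg)
qed

lemma cinner_normalized:
  assumes "z \<noteq> 0" "u = scaleC (of_real (inverse (norm z))) z"
  shows "cinner u u = 1"
  using assms by (simp add: cinner_self norm_scaleC norm_inverse)

text \<open>Indexed families rather than sets, because one basis will serve as index set both for
  itself and for its reindexed halves.\<close>

definition orthonormal_on :: "'i set \<Rightarrow> ('i \<Rightarrow> 'k::chilbert_space) \<Rightarrow> bool" where
  "orthonormal_on I a \<longleftrightarrow> (\<forall>i\<in>I. \<forall>j\<in>I. cinner (a i) (a j) = (if i = j then 1 else 0))"

lemma orthonormal_onD:
  "\<lbrakk>orthonormal_on I a; i \<in> I; j \<in> I\<rbrakk> \<Longrightarrow> cinner (a i) (a j) = (if i = j then 1 else 0)"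
  by (simp add: orthonormal_on_def)

lemma cinner_orthonormal_sum:
  assumes "orthonormal_on I a" "finite F" "F \<subseteq> I" "i \<in> F"
  shows "cinner (a i) (\<Sum>j\<in>F. scaleC (c j) (a j)) = c i"
proof -
  have "cinner (a i) (\<Sum>j\<in>F. scaleC (c j) (a j)) = (\<Sum>j\<in>F. if i = j then c j else 0)"
    unfolding cinner_sum_right cinner_scaleC_right
    by (rule sum.cong) (use assms orthonormal_onD[OF assms(1)] in \<open>auto simp: subset_iff\<close>)
  then show ?thesis using assms by simp
qed

lemma cinner_sum_left: "cinner (sum f F) x = (\<Sum>i\<in>F. cinner (f i) x)"
  by (induction F rule: infinite_finite_induct) (auto simp: cinner_add_left)

lemma norm_orthonormal_sum:
  assumes "orthonormal_on I a" "finite F" "F \<subseteq> I"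
  shows "(norm (\<Sum>i\<in>F. scaleC (c i) (a i)))\<^sup>2 = (\<Sum>i\<in>F. (cmod (c i))\<^sup>2)"
proof -
  have "cinner (\<Sum>i\<in>F. scaleC (c i) (a i)) (\<Sum>i\<in>F. scaleC (c i) (a i)) = (\<Sum>i\<in>F. cnj (c i) * c i)"
    unfolding cinner_sum_left cinner_scaleC_left
    by (intro sum.cong refl) (simp add: cinner_orthonormal_sum[OF assms])
  then show ?thesis
    by (simp add: norm_sq_cinner cmod_power2) (simp add: power2_eq_square)
qed

text \<open>With \<open>y\<close> the orthogonal projection of \<open>x\<close> to the span of the
  finite family, the squared norm of \<open>x - y\<close> is the difference of the two
  sides.\<close>

lemma bessel:
  assumes "orthonormal_on I a" "finite F" "F \<subseteq> I"
  shows "(\<Sum>i\<in>F. (cmod (cinner (a i) x))\<^sup>2) \<le> (norm x)\<^sup>2"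
proof -
  define y where "y = (\<Sum>i\<in>F. scaleC (cinner (a i) x) (a i))"
  have "cinner y x = (\<Sum>i\<in>F. cnj (cinner (a i) x) * cinner (a i) x)"
    by (simp add: y_def cinner_sum_left cinner_scaleC_left)
  then have yx: "cinner y x = of_real (\<Sum>i\<in>F. (cmod (cinner (a i) x))\<^sup>2)"
    by (simp add: complex_norm_square mult.commute del: of_real_power)
  then have xy: "cinner x y = of_real (\<Sum>i\<in>F. (cmod (cinner (a i) x))\<^sup>2)"
    by (metis cinner_commute complex_cnj_complex_of_real)
  have yy: "cinner y y = of_real (\<Sum>i\<in>F. (cmod (cinner (a i) x))\<^sup>2)"
    unfolding y_def cinner_self norm_orthonormal_sum[OF assms] ..
  have "complex_of_real ((norm (x - y))\<^sup>2)
      = of_real ((norm x)\<^sup>2 - (\<Sum>i\<in>F. (cmod (cinner (a i) x))\<^sup>2))"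
    unfolding cinner_self[symmetric] cinner_diff_left cinner_diff_right xy yx yy of_real_diff by simp
  then have "(norm (x - y))\<^sup>2 = (norm x)\<^sup>2 - (\<Sum>i\<in>F. (cmod (cinner (a i) x))\<^sup>2)"
    unfolding of_real_eq_iff .
  then show ?thesis using zero_le_power2[of "norm (x - y)"] by linarith
qed

text \<open>The Cauchy-Schwarz inequality, as the Bessel inequality for the single vector obtained
  by normalizing \<open>x\<close>.\<close>

lemma norm_cinner_le: "cmod (cinner x y) \<le> norm x * norm y"
proof (cases "x = 0")
  case False
  define u where "u = scaleC (of_real (inverse (norm x))) x"
  have "orthonormal_on {()} (\<lambda>_. u)"
    using cinner_normalized[OF False u_def] by (simp add: orthonormal_on_def)
  from bessel[OF this, of "{()}" y] have "(cmod (cinner u y))\<^sup>2 \<le> (norm y)\<^sup>2" by simp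
  then have "cmod (cinner u y) \<le> norm y" by (simp add: power2_le_iff_abs_le)
  then show ?thesis
    using False by (simp add: u_def cinner_scaleC_left norm_mult norm_divide norm_inverse field_simps)
qed simp

lemma bounded_linear_cinner: "bounded_linear (cinner x)"
proof (rule bounded_linear_intro)
  show "cinner x (r *\<^sub>R y) = r *\<^sub>R cinner x y" for r y
    by (simp flip: scaleC_of_real add: cinner_scaleC_right scaleR_conv_of_real)
  show "norm (cinner x y) \<le> norm y * norm x" for y
    using norm_cinner_le[of x y] by (simp add: mult.commute)
qed (rule cinner_add_right)

lemma bounded_linear_scaleC: "bounded_linear (scaleC c)"
proof (rule bounded_linear_intro)
  show "scaleC c (r *\<^sub>R y) = r *\<^sub>R scaleC c y" for r y
    by (simp flip: scaleC_of_real add: scaleC_scaleC mult.commute)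
  show "norm (scaleC c y) \<le> norm y * cmod c" for y
    by (simp add: norm_scaleC mult.commute)
qed (rule scaleC_add_right)

section \<open>Partial isometries between orthonormal families\<close>

text \<open>For orthonormal families this is the partial isometry that sends \<open>a i\<close> to
  \<open>g i\<close> and vanishes on the orthogonal complement of the \<open>a i\<close>.\<close>

definition transport :: "'i set \<Rightarrow> ('i \<Rightarrow> 'k) \<Rightarrow> ('i \<Rightarrow> 'k) \<Rightarrow> 'k \<Rightarrow> 'k::chilbert_space" where
  "transport I a g x = (\<Sum>\<^sub>\<infinity>i\<in>I. scaleC (cinner (a i) x) (g i))"

text \<open>The squared coefficients are summable by \<open>bessel\<close>. Orthonormality of
  \<open>g\<close> equates their finite sums with squared norms of vector sums, so small tails give
  the Cauchy criterion.\<close>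

lemma transport_has_sum:
  assumes a: "orthonormal_on I a" and g: "orthonormal_on I g"
  shows "((\<lambda>i. scaleC (cinner (a i) x) (g i)) has_sum transport I a g x) I"
proof -
  have "(\<lambda>i. (cmod (cinner (a i) x))\<^sup>2) summable_on I"
    by (rule nonneg_bounded_partial_sums_imp_summable_on[where C = "(norm x)\<^sup>2"])
      (auto intro!: eventually_finite_subsets_at_top_weakI bessel[OF a])
  then have S: "((\<lambda>i. (cmod (cinner (a i) x))\<^sup>2) has_sum (\<Sum>\<^sub>\<infinity>i\<in>I. (cmod (cinner (a i) x))\<^sup>2)) I"
    (is "(?f has_sum ?S) I") by simp
  have "(\<lambda>i. scaleC (cinner (a i) x) (g i)) summable_on I"
  proof (rule summable_on_Cauchy)
    fix e :: real assume e: "e > 0"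
    obtain F0 where F0: "finite F0" "F0 \<subseteq> I" "dist (sum ?f F0) ?S \<le> e\<^sup>2"
      using has_sum_finite_approximation[OF S, of "e\<^sup>2"] e by auto
    have "norm (\<Sum>i\<in>F. scaleC (cinner (a i) x) (g i)) \<le> e" if F: "finite F" "F \<subseteq> I" "F \<inter> F0 = {}" for F
    proof -
      have "sum ?f (F \<union> F0) \<le> ?S"
        using F F0 S by (intro finite_sum_le_has_sum) auto
      then have "sum ?f F \<le> e\<^sup>2"
        using F F0 by (simp add: sum.union_disjoint dist_real_def)
      then have "(norm (\<Sum>i\<in>F. scaleC (cinner (a i) x) (g i)))\<^sup>2 \<le> e\<^sup>2"
        using norm_orthonormal_sum[OF g F(1,2)] by simp
      then show ?thesis using e by (simp add: power2_le_iff_abs_le)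
    qed
    then show "\<exists>F0. finite F0 \<and> F0 \<subseteq> I \<and> (\<forall>F. finite F \<and> F \<subseteq> I \<and> F \<inter> F0 = {} \<longrightarrow>
        norm (\<Sum>i\<in>F. scaleC (cinner (a i) x) (g i)) \<le> e)"
      using F0 by blast
  qed
  then show ?thesis unfolding transport_def by simp
qed

context
  fixes I :: "'i set" and a g :: "'i \<Rightarrow> 'k::chilbert_space"
  assumes a: "orthonormal_on I a" and g: "orthonormal_on I g"
begin

lemma norm_transport_le: "norm (transport I a g x) \<le> norm x"
proof -
  have "norm (\<Sum>i\<in>F. scaleC (cinner (a i) x) (g i)) \<le> norm x" if "finite F" "F \<subseteq> I" for F
  proof -
    have "(norm (\<Sum>i\<in>F. scaleC (cinner (a i) x) (g i)))\<^sup>2 \<le> (norm x)\<^sup>2"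
      using norm_orthonormal_sum[OF g that] bessel[OF a that] by simp
    then show ?thesis by (simp add: power2_le_iff_abs_le)
  qed
  then show ?thesis
    using transport_has_sum[OF a g, of x] unfolding has_sum_def
    by (intro tendsto_upperbound[OF tendsto_norm])
      (auto intro!: eventually_finite_subsets_at_top_weakI)
qed

lemma transport_add: "transport I a g (x + y) = transport I a g x + transport I a g y"
proof -
  have "((\<lambda>i. scaleC (cinner (a i) (x + y)) (g i)) has_sum (transport I a g x + transport I a g y)) I"
    unfolding cinner_add_right scaleC_add_left
    by (intro has_sum_add transport_has_sum a g)
  then show ?thesis
    unfolding transport_def[of _ _ _ "x + y"] by (rule infsumI)
qed

lemma transport_scaleC: "transport I a g (scaleC c x) = scaleC c (transport I a g x)"
proof -
  have "((\<lambda>i. scaleC (cinner (a i) (scaleC c x)) (g i)) has_sum scaleC c (transport I a g x)) I"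
    using has_sum_bounded_linear[OF bounded_linear_scaleC transport_has_sum[OF a g, of x], of c]
    by (simp add: cinner_scaleC_right scaleC_scaleC)
  then show ?thesis
    unfolding transport_def[of _ _ _ "scaleC c x"] by (rule infsumI)
qed

lemma bounded_linear_transport: "bounded_linear (transport I a g)"
proof (rule bounded_linear_intro[where K = 1])
  show "transport I a g (r *\<^sub>R x) = r *\<^sub>R transport I a g x" for r x
    by (simp flip: scaleC_of_real add: transport_scaleC)
qed (auto simp: transport_add norm_transport_le)

lemma cinner_transport_has_sum:
  "((\<lambda>i. cinner (a i) x * cinner y (g i)) has_sum cinner y (transport I a g x)) I"
  using has_sum_bounded_linear[OF bounded_linear_cinner transport_has_sum[OF a g, of x], of y]
  by (simp add: cinner_scaleC_right)

lemma cinner_transport: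
  assumes "j \<in> I"
  shows "cinner (g j) (transport I a g x) = cinner (a j) x"
proof -
  have "((\<lambda>i. cinner (a i) x * cinner (g j) (g i)) has_sum cinner (a j) x) I \<longleftrightarrow>
      ((\<lambda>i. cinner (a i) x) has_sum cinner (a j) x) {j}"
    using assms orthonormal_onD[OF g] by (intro has_sum_cong_neutral) auto
  then have "((\<lambda>i. cinner (a i) x * cinner (g j) (g i)) has_sum cinner (a j) x) I"
    by (simp add: has_sum_finite_iff)
  then show ?thesis
    using cinner_transport_has_sum has_sum_unique by blast
qed

lemma cinner_transport_orthogonal:
  assumes "\<And>i. i \<in> I \<Longrightarrow> cinner y (g i) = 0"
  shows "cinner y (transport I a g x) = 0"
proof -
  have "((\<lambda>i. cinner (a i) x * cinner y (g i)) has_sum 0) I"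
    using assms by (intro has_sum_0) auto
  then show ?thesis using cinner_transport_has_sum has_sum_unique by blast
qed

end

text \<open>Both inner products are sums of one and the same series, the left one after complex
  conjugation.\<close>

lemma transport_adjoint:
  assumes a: "orthonormal_on I a" and g: "orthonormal_on I g"
  shows "cinner (transport I a g x) y = cinner x (transport I g a y)"
proof -
  have "((\<lambda>i. cnj (cinner (a i) x * cinner y (g i))) has_sum cnj (cinner y (transport I a g x))) I"
    by (rule has_sum_bounded_linear[OF bounded_linear_cnj cinner_transport_has_sum[OF a g]])
  then have "((\<lambda>i. cinner (g i) y * cinner x (a i)) has_sum cinner (transport I a g x) y) I"
    by (simp add: cinner_commute[symmetric] mult.commute)
  then show ?thesis
    using cinner_transport_has_sum[OF g a] has_sum_unique by blast
qed

section \<open>Bases and isometries in the algebra of bounded operators\<close>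

lemma bounded_operators_simps [simp]:
  "T \<in> carrier bounded_operators \<longleftrightarrow>
    (\<forall>c x. blinfun_apply T (scaleC c x) = scaleC c (blinfun_apply T x))"
  "T \<otimes>\<^bsub>bounded_operators\<^esub> T' = T o\<^sub>L T'"
  "T \<oplus>\<^bsub>bounded_operators\<^esub> T' = T + T'"
  "\<one>\<^bsub>bounded_operators\<^esub> = id_blinfun"
  "\<zero>\<^bsub>bounded_operators\<^esub> = 0"
  by (simp_all add: bounded_operators_def)

text \<open>The involution is a definite description. Nondegeneracy of the inner product gives
  uniqueness, so exhibiting one adjoint evaluates it.\<close>

lemma star_bounded_operators_eqI:
  assumes "\<And>x y. cinner (blinfun_apply T x) y = cinner x (blinfun_apply S y)"
  shows "star bounded_operators T = S"
proof -
  have "(THE S. \<forall>x y. cinner (blinfun_apply T x) y = cinner x (blinfun_apply S y)) = S"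
  proof (rule the_equality)
    fix S' assume "\<forall>x y. cinner (blinfun_apply T x) y = cinner x (blinfun_apply S' y)"
    then show "S' = S"
      by (intro blinfun_eqI cinner_ext) (simp flip: assms)
  qed (simp add: assms)
  then show ?thesis by (simp add: bounded_operators_def)
qed

text \<open>Zorn's lemma gives a maximal orthonormal set; a nonzero vector orthogonal to it could be
  normalized and added.\<close>

lemma ex_orthonormal_basis:
  obtains B :: "'k::chilbert_space set" where "orthonormal_on B (\<lambda>x. x)"
    "\<And>z. (\<And>b. b \<in> B \<Longrightarrow> cinner b z = 0) \<Longrightarrow> z = 0"
proof -
  let ?\<A> = "{B :: 'k set. orthonormal_on B (\<lambda>x. x)}"
  have "\<exists>M\<in>?\<A>. \<forall>X\<in>?\<A>. M \<subseteq> X \<longrightarrow> X = M"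
  proof (rule subset_Zorn')
    fix \<C> assume \<C>: "subset.chain ?\<A> \<C>"
    have "cinner x y = (if x = y then 1 else 0)" if xy: "x \<in> \<Union>\<C>" "y \<in> \<Union>\<C>" for x y
    proof -
      obtain X Y where XY: "X \<in> \<C>" "Y \<in> \<C>" "x \<in> X" "y \<in> Y" using xy by auto
      then have "X \<subseteq> Y \<or> Y \<subseteq> X" using \<C> unfolding subset_chain_def by blast
      then obtain Z where "Z \<in> \<C>" "x \<in> Z" "y \<in> Z" using XY by blast
      moreover have "orthonormal_on Z (\<lambda>x. x)"
        using \<C> \<open>Z \<in> \<C>\<close> unfolding subset_chain_def by blast
      ultimately show ?thesis using orthonormal_onD by fastforce
    qed
    then show "\<Union>\<C> \<in> ?\<A>" by (simp add: orthonormal_on_def)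
  qed
  then obtain B where B: "orthonormal_on B (\<lambda>x :: 'k. x)"
    and max: "\<And>X. orthonormal_on X (\<lambda>x. x) \<Longrightarrow> B \<subseteq> X \<Longrightarrow> X = B"
    by blast
  have "z = 0" if z: "\<And>b. b \<in> B \<Longrightarrow> cinner b z = 0" for z
  proof (rule ccontr)
    assume nz: "z \<noteq> 0"
    define u where "u = scaleC (of_real (inverse (norm z))) z"
    have uu: "cinner u u = 1"
      by (rule cinner_normalized[OF nz u_def])
    have bu: "cinner b u = 0" "cinner u b = 0" if "b \<in> B" for b
      using z[OF that] cinner_commute[of z b]
      by (auto simp: u_def cinner_scaleC_left cinner_scaleC_right)
    then have "orthonormal_on (insert u B) (\<lambda>x. x)"
      using B uu by (auto simp: orthonormal_on_def)
    then have "u \<in> B" using max[of "insert u B"] by blast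
    then show False using bu uu by fastforce
  qed
  with B show ?thesis using that by blast
qed

text \<open>A bijection between an orthonormal basis \<open>B\<close> and \<open>B <+> B\<close> identifies the space with the
  direct sum of two copies of itself.\<close>

lemma ex_bounded_operators_isometries:
  assumes "infinite_dimensional TYPE('k::chilbert_space)"
  obtains s :: "bool \<Rightarrow> 'k::chilbert_space \<Rightarrow>\<^sub>L 'k" where
    "\<And>b. s b \<in> carrier bounded_operators" "\<And>b. star bounded_operators (s b) \<in> carrier bounded_operators"
    "\<And>b c. star bounded_operators (s b) o\<^sub>L s c = (if b = c then id_blinfun else 0)"
    "(s False o\<^sub>L star bounded_operators (s False)) + (s True o\<^sub>L star bounded_operators (s True)) = id_blinfun"
proof -
  obtain B :: "'k set" where B: "orthonormal_on B (\<lambda>x. x)"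
    and total: "\<And>z. (\<And>b. b \<in> B \<Longrightarrow> cinner b z = 0) \<Longrightarrow> z = 0"
    using ex_orthonormal_basis by blast
  \<comment> \<open>A finite total orthonormal set would span: subtracting its finite expansion from
    \<open>x\<close> leaves a vector orthogonal to \<open>B\<close>.\<close>
  have "infinite B"
  proof
    assume fin: "finite B"
    have "x \<in> scaleC.span B" for x
    proof -
      have "x - (\<Sum>b\<in>B. scaleC (cinner b x) b) = 0"
        by (rule total) (simp add: cinner_diff_right cinner_orthonormal_sum[OF B fin order_refl])
      then have "x = (\<Sum>b\<in>B. scaleC (cinner b x) b)" by simp
      also have "\<dots> \<in> scaleC.span B"
        by (intro scaleC.span_sum scaleC.span_scale scaleC.span_base)
      finally show ?thesis .
    qed
    then have "scaleC.span B = UNIV" by blast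
    then show False using assms fin unfolding infinite_dimensional_def by blast
  qed
  then obtain f where f: "bij_betw f (B <+> B) B"
    using card_of_ordIso[THEN iffD2, OF card_of_Plus_infinite1[OF _ card_of_mono1[OF order_refl]]]
    by blast
  \<comment> \<open>The bijection \<open>f\<close>, which exists since doubling does not enlarge an
    infinite cardinal, splits \<open>B\<close> into two disjoint halves, each enumerated by
    \<open>B\<close>. The isometry \<open>s b\<close> will carry the basis onto the half
    \<open>g b\<close>.\<close>
  define g where "g b x = f (if b then Inl x else Inr x)" for b x
  have gB: "g b x \<in> B" if "x \<in> B" for b x
    using that f by (auto simp: g_def bij_betw_def)
  have g_inj: "g b x = g c y \<longleftrightarrow> b = c \<and> x = y" if "x \<in> B" "y \<in> B" for b c x y
  proof -
    have "inj_on f (B <+> B)" using f by (simp add: bij_betw_def)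
    from inj_on_eq_iff[OF this] show ?thesis using that by (cases b; cases c) (simp_all add: g_def InlI InrI)
  qed
  have g_surj: "\<exists>b x. x \<in> B \<and> y = g b x" if "y \<in> B" for y
  proof -
    have "y \<in> f ` (B <+> B)" using f that by (simp add: bij_betw_def)
    then obtain z where "z \<in> B <+> B" "y = f z" by blast
    then obtain x where "x \<in> B" "y = f (Inl x) \<or> y = f (Inr x)" by blast
    then have "y = g True x \<or> y = g False x" by (simp add: g_def)
    with \<open>x \<in> B\<close> show ?thesis by blast
  qed
  have cg: "cinner (g b x) (g c y) = (if b = c \<and> x = y then 1 else 0)" if "x \<in> B" "y \<in> B" for b c x y
    using orthonormal_onD[OF B gB[OF that(1)] gB[OF that(2)], of b c] g_inj[OF that, of b c] by auto
  have G: "orthonormal_on B (g b)" for b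
    by (simp add: orthonormal_on_def cg)
  define s where "s b = Blinfun (transport B (\<lambda>x. x) (g b))" for b
  define s' where "s' b = Blinfun (transport B (g b) (\<lambda>x. x))" for b
  have s: "blinfun_apply (s b) = transport B (\<lambda>x. x) (g b)" for b
    unfolding s_def by (rule bounded_linear_Blinfun_apply[OF bounded_linear_transport[OF B G]])
  have s': "blinfun_apply (s' b) = transport B (g b) (\<lambda>x. x)" for b
    unfolding s'_def by (rule bounded_linear_Blinfun_apply[OF bounded_linear_transport[OF G B]])
  have star_s: "star bounded_operators (s b) = s' b" for b
    by (rule star_bounded_operators_eqI) (simp add: s s' transport_adjoint[OF B G])
  have "s' b o\<^sub>L s c = (if b = c then id_blinfun else 0)" for b c
  proof (rule blinfun_eqI)
    fix x
    \<comment> \<open>By totality of \<open>B\<close>, an identity between operators only has to be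
      tested against basis vectors.\<close>
    have "cinner y (s' b (s c x) - (if b = c then x else 0)) = 0" if y: "y \<in> B" for y
    proof -
      have "cinner y (s' b (s c x)) = cinner (g b y) (s c x)"
        unfolding s' using cinner_transport[OF G B y] by simp
      also have "\<dots> = (if b = c then cinner y x else 0)"
        unfolding s using cinner_transport[OF B G y, of c x]
          cinner_transport_orthogonal[OF B G, of "g b y" c x] cg[OF y] by auto
      finally show ?thesis by (simp add: cinner_diff_right)
    qed
    from total[OF this] show "blinfun_apply (s' b o\<^sub>L s c) x = blinfun_apply (if b = c then id_blinfun else 0) x"
      by (auto split: if_splits)
  qed
  moreover have "(s False o\<^sub>L s' False) + (s True o\<^sub>L s' True) = id_blinfun"
  proof (rule blinfun_eqI)
    fix x
    have "cinner y (s False (s' False x) + s True (s' True x) - x) = 0" if "y \<in> B" for y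
    proof -
      obtain b z where z: "z \<in> B" "y = g b z" using g_surj[OF \<open>y \<in> B\<close>] by blast
      have "cinner (g b z) (s b (s' b x)) = cinner (g b z) x"
        unfolding s s' using cinner_transport[OF B G z(1)] cinner_transport[OF G B z(1)] by simp
      moreover have "cinner (g b z) (s (\<not> b) v) = 0" for v
        unfolding s by (rule cinner_transport_orthogonal[OF B G]) (simp add: cg z(1))
      ultimately show ?thesis
        unfolding z(2) by (cases b) (simp_all add: cinner_diff_right cinner_add_right)
    qed
    from total[OF this]
    show "blinfun_apply ((s False o\<^sub>L s' False) + (s True o\<^sub>L s' True)) x = blinfun_apply id_blinfun x"
      by (simp add: blinfun.add_left)
  qed
  ultimately show ?thesis
    by (intro that[of s]) (simp_all add: star_s s s' transport_scaleC[OF B G] transport_scaleC[OF G B])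
qed

subsection \<open>The theorem\<close>

text \<open>The zero algebra is the algebra of functions on the empty space, so the hypothesis
  identifies its image with the bounded functions on the empty set. This is the case left open by
  \<open>cuntz_pair_trivial\<close>.\<close>

lemma (in natural_star_homs) zero_algebra_trivial:
  assumes disc: "discretizes_continuous_functions Fobj \<eta>"
    and A: "cstar_algebra A" and z: "\<one>\<^bsub>A\<^esub> = \<zero>\<^bsub>A\<^esub>"
  shows "carrier (Fobj A) = {\<zero>\<^bsub>Fobj A\<^esub>}"
proof -
  interpret A: cstar_algebra A by (rule A)
  have cA: "carrier A = {\<zero>\<^bsub>A\<^esub>}" by (rule A.carrier_trivial[OF z])
  let ?X = "discrete_topology ({} :: ('u \<Rightarrow> complex) set)"
  let ?\<phi> = "\<lambda>f\<in>carrier (continuous_functions ?X). \<zero>\<^bsub>A\<^esub>"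
  \<comment> \<open>On the empty space extensionality leaves exactly one function, the one that is
    \<open>undefined\<close> everywhere.\<close>
  have cX: "carrier (continuous_functions ?X) = {\<lambda>x. undefined}"
    by (auto simp: extensional_def fun_eq_iff)
  have "?\<phi> \<in> star_iso (continuous_functions ?X) A"
    unfolding star_iso_def star_hom_def ring_hom_def cX cA
    by (auto simp: z restrict_def extensional_def bij_betw_def)
  moreover have "compact_space ?X" "Hausdorff_space ?X"
    by (simp_all add: compact_space_discrete_topology)
  ultimately obtain \<psi> where "\<psi> \<in> star_iso (Fobj A) (bounded_functions (topspace ?X))"
    using disc A unfolding discretizes_continuous_functions_def by blast
  then have "bij_betw \<psi> (carrier (Fobj A)) {\<lambda>x. undefined}"
    by (auto simp: star_iso_def bij_betw_def extensional_def fun_eq_iff)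
  then have "card (carrier (Fobj A)) = 1"
    by (simp add: bij_betw_same_card)
  then obtain v where v: "carrier (Fobj A) = {v}" by (auto simp: card_1_singleton_iff)
  interpret F: awstar_algebra "Fobj A" by (rule obj[OF A])
  show ?thesis using v F.zero_closed by auto
qed

theorem mainTheorem2:
  fixes Fobj :: "'u star_algebra \<Rightarrow> 'v star_algebra"
    and Fmap :: "'u star_algebra \<Rightarrow> 'u star_algebra \<Rightarrow> ('u \<Rightarrow> 'u) \<Rightarrow> ('v \<Rightarrow> 'v)"
    and \<eta> :: "'u star_algebra \<Rightarrow> 'u \<Rightarrow> 'v"
    and A :: "'u star_algebra"
    and \<alpha> :: "('k::chilbert_space \<Rightarrow>\<^sub>L 'k) \<Rightarrow> 'u"
  assumes "cstar_awstar_functor Fobj Fmap"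
    and "natural_star_homs Fobj Fmap \<eta>"
    and "discretizes_continuous_functions Fobj \<eta>"
    and "cstar_algebra A"
    and "infinite_dimensional TYPE('k)"
    and "\<alpha> \<in> star_hom bounded_operators A"
  shows "carrier (Fobj A) = {\<zero>\<^bsub>Fobj A\<^esub>}"
proof -
  interpret natural_star_homs Fobj Fmap \<eta> by fact
  interpret A: cstar_algebra A by fact
  obtain S :: "bool \<Rightarrow> 'k \<Rightarrow>\<^sub>L 'k" where S: "\<And>b. S b \<in> carrier bounded_operators"
    "\<And>b. star bounded_operators (S b) \<in> carrier bounded_operators"
    "\<And>b c. star bounded_operators (S b) o\<^sub>L S c = (if b = c then id_blinfun else 0)"
    "(S False o\<^sub>L star bounded_operators (S False)) + (S True o\<^sub>L star bounded_operators (S True)) = id_blinfun"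
    using ex_bounded_operators_isometries[OF assms(5)] by metis
  note h = star_homD[OF assms(6)]
  \<comment> \<open>Preservation of zero is not part of \<open>ring_hom\<close>; it follows from
    additivity and cancellation in \<open>A\<close>.\<close>
  have \<alpha>_0: "\<alpha> 0 = \<zero>\<^bsub>A\<^esub>"
  proof -
    have z: "(0 :: 'k \<Rightarrow>\<^sub>L 'k) \<in> carrier bounded_operators"
      using scaleC.scale_zero_right by simp
    have "\<alpha> 0 \<oplus>\<^bsub>A\<^esub> \<alpha> 0 = \<alpha> 0 \<oplus>\<^bsub>A\<^esub> \<zero>\<^bsub>A\<^esub>"
      using h(3)[OF z z] h(1)[OF z] by simp
    then show ?thesis using h(1)[OF z] by simp
  qed
  have \<alpha>_1: "\<alpha> id_blinfun = \<one>\<^bsub>A\<^esub>" using h(4) by simp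
  have "cuntz_pair A (\<lambda>b. \<alpha> (S b))"
  proof unfold_locales
    show "\<alpha> (S b) \<in> carrier A" for b by (rule h(1)[OF S(1)])
    show "star A (\<alpha> (S b)) \<otimes>\<^bsub>A\<^esub> \<alpha> (S c) = (if b = c then \<one>\<^bsub>A\<^esub> else \<zero>\<^bsub>A\<^esub>)" for b c
      using h(2)[OF S(2) S(1), of b c, symmetric] by (cases "b = c") (simp_all add: h(6)[OF S(1)] S(3) \<alpha>_0 \<alpha>_1)
    have SS: "(S b o\<^sub>L star bounded_operators (S b)) \<in> carrier bounded_operators" for b
      using S(1,2) by simp
    have \<alpha>_SS: "\<alpha> (S b) \<otimes>\<^bsub>A\<^esub> star A (\<alpha> (S b)) = \<alpha> (S b o\<^sub>L star bounded_operators (S b))" for b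
      using h(2)[OF S(1) S(2), of b b] by (simp add: h(6)[OF S(1)])
    show "\<alpha> (S False) \<otimes>\<^bsub>A\<^esub> star A (\<alpha> (S False)) \<oplus>\<^bsub>A\<^esub>
        \<alpha> (S True) \<otimes>\<^bsub>A\<^esub> star A (\<alpha> (S True)) = \<one>\<^bsub>A\<^esub>"
      unfolding \<alpha>_SS using h(3)[OF SS SS, of False True] by (simp add: S(4) \<alpha>_1)
  qed
  \<comment> \<open>The two lemmas cover the cases that unit and zero of \<open>A\<close> differ or
    coincide.\<close>
  then show ?thesis
    using cuntz_pair_trivial[OF assms(3)] zero_algebra_trivial[OF assms(3,4)] by blast
qed

end
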